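(* Let $\Omega \subset \mathbb{C}^n$ be an ellipsoid and let $B : L^2(\Omega) \to H^2(\Omega)$ be the Bergman projection on $\Omega$. For each nonnegative integer $N$, let $P_N$ be the space of complex-valued (not necessarily holomorphic) polynomial functions on $\Omega$ of degree at most $N$ in the real coordinates, and let $HP_N$ be the space of holomorphic polynomial functions on $\Omega$ of degree at most $N$. Then for each nonnegative integer $N$, $B(P_N) = HP_N$.
   Context: Write $z=(z_1,\dots,z_n)$ for the coordinates of $\mathbb{C}^n$, $x_j=\operatorname{Re} z_j$, $y_j=\operatorname{Im} z_j$, $x=(x_1,\dots,x_n)$, $y=(y_1,\dots,y_n)$. For a domain $\Omega\subset\mathbb{C}^n$, $L^2(\Omega)$ is the space of complex-valued functions square-integrable with respect to Lebesgue measure $dV$, with inner product $\langle f,g\rangle=\int_\Omega f\bar g\,dV$. $H^2(\Omega)$ denotes the closed subspace of $L^2(\Omega)$ consisting of holomorphic functions (the Bergman space). The Bergman projection $B:L^2(\Omega)\to H^2(\Omega)$ is the orthogonal projection of $L^2(\Omega)$ onto $H^2(\Omega)$. For multi-indices $\alpha,\beta,\gamma$ and a nonnegative integer $N$, $$P_N=\Big\{\sum_{|\alpha|+|\beta|\le N}c_{\alpha,\beta}x^\alpha y^\beta : c_{\alpha,\beta}\in\mathbb{C}\Big\},\qquad HP_N=\Big\{\sum_{|\gamma|\le N}d_\gamma z^\gamma : d_\gamma\in\mathbb{C}\Big\},$$ viewed as functions on $\Omega$. An ellipsoid in $\mathbb{C}^n\cong\mathbb{R}^{2n}$ means an arbitrary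 (open, solid) real ellipsoid, i.e. the image of the open unit ball of $\mathbb{R}^{2n}$ under an invertible real affine map; equivalently, a bounded domain $\{z : r(x,y)<0\}$ with $r$ a real polynomial of degree $2$ with positive definite quadratic part, vanishing on the boundary. It need not be defined by a complex-Hermitian form. *)

theory Defs
  imports "HOL-Analysis.Analysis"
begin

text \<open>
  Complex n-space is \<^typ>\<open>complex ^ 'n\<close>; its norm is the Euclidean one, so as a real vector
  space it is Euclidean space of dimension 2n.  Functions on a domain are represented by
  \<^const>\<open>extensional\<close> functions, so that two of them are equal iff they agree on the domain.
\<close>

definition ellipsoid :: "(complex ^ 'n) set \<Rightarrow> bool" where
  "ellipsoid \<Omega> \<longleftrightarrow>
     (\<exists>(A :: complex ^ 'n \<Rightarrow> complex ^ 'n) a. linear A \<and> bij A \<and> \<Omega> = (\<lambda>v. a + A v) ` ball 0 1)"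
  \<comment> \<open>\<^const>\<open>linear\<close> is real linearity.\<close>

definition L2_space :: "(complex ^ 'n) set \<Rightarrow> (complex ^ 'n \<Rightarrow> complex) set" where
  "L2_space \<Omega> = {f \<in> extensional \<Omega>. f \<in> borel_measurable (lebesgue_on \<Omega>) \<and>
                    integrable (lebesgue_on \<Omega>) (\<lambda>z. (cmod (f z))\<^sup>2)}"

definition L2_inner ::
  "(complex ^ 'n) set \<Rightarrow> (complex ^ 'n \<Rightarrow> complex) \<Rightarrow> (complex ^ 'n \<Rightarrow> complex) \<Rightarrow> complex" where
  "L2_inner \<Omega> f g = (LINT z|lebesgue_on \<Omega>. f z * cnj (g z))"

text \<open>
  Holomorphy in several variables on an open set: the real Frechet derivative exists at every
  point of the set and is complex linear.
\<close>

definition holomorphic_on_vec :: "(complex ^ 'n \<Rightarrow> complex) \<Rightarrow> (complex ^ 'n) set \<Rightarrow> bool" where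
  "holomorphic_on_vec f \<Omega> \<longleftrightarrow>
     (\<forall>z\<in>\<Omega>. \<exists>D. (f has_derivative D) (at z) \<and> (\<forall>c v. D (c *s v) = c * D v))"

definition bergman_space :: "(complex ^ 'n) set \<Rightarrow> (complex ^ 'n \<Rightarrow> complex) set" where
  "bergman_space \<Omega> = {f \<in> L2_space \<Omega>. holomorphic_on_vec f \<Omega>}"

text \<open>
  The orthogonal projection of \<open>f\<close> is the element \<open>h\<close> of the Bergman space with \<open>f - h\<close>
  orthogonal to the Bergman space.  For open \<open>\<Omega>\<close> it exists because the Bergman space is closed
  in \<open>L\<^sup>2\<close>, and it is unique as a function, not just almost everywhere, because holomorphic
  functions are continuous.  \<^const>\<open>L2_space\<close> consists of functions rather than of classes modulo
  null sets; the projection depends only on the class of its argument.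
\<close>

definition bergman_projection ::
  "(complex ^ 'n) set \<Rightarrow> (complex ^ 'n \<Rightarrow> complex) \<Rightarrow> (complex ^ 'n \<Rightarrow> complex)" where
  "bergman_projection \<Omega> =
     (\<lambda>f\<in>L2_space \<Omega>. THE h. h \<in> bergman_space \<Omega> \<and>
        (\<forall>g\<in>bergman_space \<Omega>. L2_inner \<Omega> (\<lambda>z. f z - h z) g = 0))"

definition multi_degree :: "('n::finite \<Rightarrow> nat) \<Rightarrow> nat" where
  "multi_degree \<alpha> = (\<Sum>j\<in>UNIV. \<alpha> j)"

definition poly_space :: "(complex ^ 'n) set \<Rightarrow> nat \<Rightarrow> (complex ^ 'n \<Rightarrow> complex) set" where
  "poly_space \<Omega> N =
     {(\<lambda>z\<in>\<Omega>. \<Sum>(\<alpha>, \<beta>) | multi_degree \<alpha> + multi_degree \<beta> \<le> N.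
         c \<alpha> \<beta> * (\<Prod>j\<in>UNIV. complex_of_real (Re (z $ j)) ^ \<alpha> j)
               * (\<Prod>j\<in>UNIV. complex_of_real (Im (z $ j)) ^ \<beta> j)) | c. True}"

definition hol_poly_space :: "(complex ^ 'n) set \<Rightarrow> nat \<Rightarrow> (complex ^ 'n \<Rightarrow> complex) set" where
  "hol_poly_space \<Omega> N =
     {(\<lambda>z\<in>\<Omega>. \<Sum>\<gamma> | multi_degree \<gamma> \<le> N. d \<gamma> * (\<Prod>j\<in>UNIV. z $ j ^ \<gamma> j)) | d. True}"

text \<open>The index sets of these sums are finite, so the sums do not degenerate to 0.\<close>

lemma finite_multi_degree_le: "finite {\<gamma> :: 'n::finite \<Rightarrow> nat. multi_degree \<gamma> \<le> N}"
proof (rule finite_subset)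
  show "{\<gamma> :: 'n \<Rightarrow> nat. multi_degree \<gamma> \<le> N} \<subseteq> (UNIV :: 'n set) \<rightarrow>\<^sub>E {..N}"
  proof
    fix \<gamma> :: "'n \<Rightarrow> nat" assume "\<gamma> \<in> {\<gamma>. multi_degree \<gamma> \<le> N}"
    then have "\<gamma> j \<le> N" for j
      using member_le_sum[of j UNIV \<gamma>] by (simp add: multi_degree_def)
    then show "\<gamma> \<in> UNIV \<rightarrow>\<^sub>E {..N}" by auto
  qed
  show "finite ((UNIV :: 'n set) \<rightarrow>\<^sub>E {..N})" by (intro finite_PiE) auto
qed

lemma finite_multi_degree_pair_le:
  "finite {(\<alpha> :: 'n::finite \<Rightarrow> nat, \<beta> :: 'n \<Rightarrow> nat). multi_degree \<alpha> + multi_degree \<beta> \<le> N}"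
  by (rule finite_subset[OF _ finite_cartesian_product
        [OF finite_multi_degree_le[of N] finite_multi_degree_le[of N]]]) auto

end

theory Submission
  imports Defs "HOL-Complex_Analysis.Cauchy_Integral_Formula" "HOL-Library.Function_Algebras"
begin

text \<open>
  Let \<open>r\<close> be the defining quadratic polynomial of the ellipsoid \<open>\<Omega>\<close>, negative inside and zero on the
  boundary.  The operator \<open>F q = (\<Sum>j. \<partial>\<^sub>j (r \<partial>bar\<^sub>j q))\<close> maps polynomials of degree at most \<open>N\<close> to
  such polynomials.  Its range is orthogonal to the Bergman space, because \<open>r\<close> vanishes on the
  boundary and conjugates of holomorphic functions are annihilated by \<open>\<partial>\<^sub>j\<close>; for a Bergman function
  without boundary regularity one integrates over the smaller concentric ellipsoids and passes to
  the limit.  Pairing \<open>F q\<close> with \<open>q\<close> gives minus the integral of \<open>r (\<Sum>j. |\<partial>bar\<^sub>j q|\<^sup>2)\<close>, so the kernel of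
  \<open>F\<close> consists of the holomorphic polynomials.  Hence kernel and range of \<open>F\<close> meet only in 0, they span
  the finite-dimensional polynomial space, and the Bergman projection is the component in the kernel.
\<close>

text \<open>Degree two of \<open>r\<close> is what makes the argument work: the factor
  \<open>r\<close> gives back exactly the two degrees that the two derivatives remove. For a real
  ellipsoid \<open>r\<close> also contains products of two holomorphic coordinates and of two
  conjugated ones, so only the total degree is preserved by \<open>F\<close>; the antiholomorphic
  degree is recorded beside it in order to recognise holomorphic polynomials. The operator is
  \<open>F = D* D\<close>, where \<open>D\<close> is the dbar operator and its adjoint is formed
  with the positive weight \<open>- r\<close>. This accounts both for its kernel and for the
  orthogonality of its range to holomorphic functions. Polynomials are functions on the whole space,
  whereas integrals over \<Omega> only see their values on \<Omega>. The kernel is therefore taken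
  to be the set of polynomials \<open>q\<close> with \<open>F q = 0\<close> on \<Omega>, and it is
  shown separately that such a \<open>q\<close> agrees on \<Omega> with a holomorphic polynomial.
  Integration by parts rests on the translation invariance of Lebesgue measure: functions vanishing
  on the boundary are extended by 0 to Lipschitz functions on the whole space.\<close>

section \<open>Splitting a finite-dimensional space into kernel and range\<close>

lemma (in vector_space) nontrivial_relation:
  assumes T: "finite T" and v: "\<And>k::nat. v k \<in> span T"
  shows "\<exists>a. (\<exists>k\<le>card T. a k \<noteq> 0) \<and> (\<Sum>k\<le>card T. scale (a k) (v k)) = 0"
proof (cases "inj_on v {..card T}")
  case True
  have "dependent (v ` {..card T})"
  proof (rule ccontr)
    assume "\<not> dependent (v ` {..card T})"
    from independent_span_bound[OF T this] v have "card (v ` {..card T}) \<le> card T" by blast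
    then show False using True by (simp add: card_image)
  qed
  then obtain u where u: "\<exists>x\<in>v ` {..card T}. u x \<noteq> 0" "(\<Sum>x\<in>v ` {..card T}. scale (u x) x) = 0"
    by (auto simp: dependent_finite)
  from u(2) have "(\<Sum>k\<le>card T. scale (u (v k)) (v k)) = 0" by (simp add: sum.reindex[OF True])
  with u(1) show ?thesis by (intro exI[of _ "\<lambda>k. u (v k)"]) auto
next
  case False
  then obtain i j where ij: "i \<le> card T" "j \<le> card T" "i \<noteq> j" "v i = v j" by (auto simp: inj_on_def)
  \<comment> \<open>A repetition in the family is itself a relation,
    \<open>v i - v j = 0\<close>.\<close>
  define a where "a k = (if k = i then 1 else 0) - (if k = j then 1 else (0::'a))" for k
  have "(\<Sum>k\<le>card T. scale (a k) (v k))
      = (\<Sum>k\<le>card T. if k = i then v i else 0) - (\<Sum>k\<le>card T. if k = j then v j else 0)"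
    unfolding sum_subtractf[symmetric] by (intro sum.cong) (auto simp: a_def ij scale_left_diff_distrib)
  also have "\<dots> = 0" using ij by (simp add: sum.delta)
  finally show ?thesis using ij by (intro exI[of _ a]) (auto simp: a_def)
qed

text \<open>The iterates \<open>p, F p, F (F p), ...\<close> lie in a finite-dimensional space, so
  some nontrivial combination of them is 0 and hence lies in \<open>K\<close>. If \<open>p\<close>
  itself has coefficient 0 there, the combination is \<open>F w\<close> for a shorter combination
  \<open>w\<close>, and \<open>FK\<close> strips off the \<open>F\<close>. Otherwise the relation is
  solved for \<open>p\<close>, and the terms containing \<open>F\<close> form the part in the
  range.\<close>

lemma (in vector_space) kernel_plus_range:
  assumes T: "finite T" "V \<subseteq> span T" and V: "subspace V"
    and FV: "\<And>x. x \<in> V \<Longrightarrow> F x \<in> V"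
    and F_add: "\<And>x y. x \<in> V \<Longrightarrow> y \<in> V \<Longrightarrow> F (x + y) = F x + F y"
    and F_scale: "\<And>c x. x \<in> V \<Longrightarrow> F (scale c x) = scale c (F x)"
    and K: "0 \<in> K" "K \<subseteq> V" "\<And>c x. x \<in> K \<Longrightarrow> scale c x \<in> K"
    and FK: "\<And>x. x \<in> V \<Longrightarrow> F x \<in> K \<Longrightarrow> x \<in> K"
    and p: "p \<in> V"
  shows "\<exists>h\<in>K. \<exists>q\<in>V. p = h + F q"
proof -
  let ?v = "\<lambda>k. (F ^^ k) p"
  have v: "?v k \<in> V" for k by (induction k) (auto simp: p FV)
  have F_sum: "F (\<Sum>k\<in>I. scale (a k) (?v k)) = (\<Sum>k\<in>I. scale (a k) (?v (Suc k)))" for a and I :: "nat set"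
  proof (induction I rule: infinite_finite_induct)
    case (insert i I)
    then show ?case using V v by (simp add: F_add F_scale subspace_scale subspace_sum)
  qed (use F_scale[of p 0] p in auto)
  have *: "\<exists>h\<in>K. \<exists>q\<in>V. p = h + F q"
    if "(\<Sum>k\<le>d. scale (a k) (?v k)) \<in> K" "\<exists>k\<le>d. a k \<noteq> 0" for d a
    using that
  proof (induction d arbitrary: a)
    case 0
    have "scale (inverse (a 0)) (scale (a 0) p) \<in> K" by (rule K(3)) (use 0(1) in simp)
    moreover have "scale (inverse (a 0)) (scale (a 0) p) = p" using 0(2) by simp
    ultimately have "p \<in> K" by (simp only:)
    moreover have "F 0 = 0" using F_scale[of p 0] p by simp
    ultimately show ?case using subspace_0[OF V] by (intro bexI[of _ p] bexI[of _ 0]) auto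
  next
    case (Suc d)
    define w where "w = (\<Sum>k\<le>d. scale (a (Suc k)) (?v k))"
    have w: "w \<in> V" unfolding w_def using V v by (intro subspace_sum subspace_scale)
    have eq: "(\<Sum>k\<le>Suc d. scale (a k) (?v k)) = scale (a 0) p + F w"
      unfolding w_def F_sum by (subst sum.atMost_Suc_shift) simp
    show ?case
    proof (cases "a 0 = 0")
      case True
      then have "w \<in> K" using Suc.prems(1) unfolding eq by (intro FK[OF w]) simp
      moreover have "\<exists>k\<le>d. a (Suc k) \<noteq> 0"
      proof -
        obtain k where k: "k \<le> Suc d" "a k \<noteq> 0" using Suc.prems(2) by blast
        then show ?thesis using True by (cases k) auto
      qed
      ultimately show ?thesis unfolding w_def by (rule Suc.IH)
    next
      case False
      let ?c = "inverse (a 0)"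
      have "scale ?c (scale (a 0) p + F w) \<in> K" using Suc.prems(1) unfolding eq by (rule K(3))
      moreover have "p = scale ?c (scale (a 0) p + F w) + F (scale (- ?c) w)"
        unfolding F_scale[OF w] using False by (simp add: scale_right_distrib)
      moreover have "scale (- ?c) w \<in> V" using V w by (rule subspace_scale)
      ultimately show ?thesis by blast
    qed
  qed
  have "\<exists>a. (\<exists>k\<le>card T. a k \<noteq> 0) \<and> (\<Sum>k\<le>card T. scale (a k) (?v k)) = 0"
    using T v by (intro nontrivial_relation) auto
  then obtain a where "\<exists>k\<le>card T. a k \<noteq> 0" "(\<Sum>k\<le>card T. scale (a k) (?v k)) = 0" by blast
  then show ?thesis using K(1) by (intro *[of a "card T"]) simp_all
qed

section \<open>Polynomials in the coordinates and their conjugates\<close>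

text \<open>Polynomial functions of total degree at most \<open>k\<close> and degree at most \<open>m\<close> in the conjugated
  coordinates.\<close>
inductive bipoly :: "nat \<Rightarrow> nat \<Rightarrow> (complex ^ 'n \<Rightarrow> complex) \<Rightarrow> bool" where
  const: "bipoly k m (\<lambda>z. c)"
| add: "bipoly k m f \<Longrightarrow> bipoly k m g \<Longrightarrow> bipoly k m (\<lambda>z. f z + g z)"
| coord: "bipoly k m f \<Longrightarrow> bipoly (Suc k) m (\<lambda>z. z $ j * f z)"
| coord_cnj: "bipoly k m f \<Longrightarrow> bipoly (Suc k) (Suc m) (\<lambda>z. cnj (z $ j) * f z)"

lemma bipoly_mono: "bipoly k m f \<Longrightarrow> k \<le> k' \<Longrightarrow> m \<le> m' \<Longrightarrow> bipoly k' m' f"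
proof (induction arbitrary: k' m' rule: bipoly.induct)
  case (coord k m f j)
  then show ?case by (cases k') (auto intro: bipoly.coord)
next
  case (coord_cnj k m f j)
  then show ?case by (cases k'; cases m') (auto intro: bipoly.coord_cnj)
qed (auto intro: bipoly.intros)

text \<open>Conjugated factors are counted in the total degree as well. This repairs the second
  bound when a multiplication has pushed it above the first.\<close>

lemma bipoly_diag: "bipoly k m f \<Longrightarrow> bipoly k k f"
proof (induction rule: bipoly.induct)
  case (coord k m f j)
  then show ?case by (intro bipoly_mono[OF bipoly.coord[of k k f j]]) auto
qed (auto intro: bipoly.intros)

lemma bipoly_mult:
  assumes "bipoly k m f" "bipoly k' m' g"
  shows "bipoly (k + k') (m + m') (\<lambda>z. f z * g z)"
  using assms
proof (induction rule: bipoly.induct)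
  case (const k m c)
  from const have "bipoly k' m' (\<lambda>z. c * g z)"
  proof (induction rule: bipoly.induct)
    case (const k m d)
    show ?case by (rule bipoly.const)
  next
    case (add k m f g)
    then show ?case using bipoly.add[of k m "\<lambda>z. c * f z" "\<lambda>z. c * g z"] by (simp add: algebra_simps)
  next
    case (coord k m f j)
    then show ?case using bipoly.coord[of k m "\<lambda>z. c * f z" j] by (simp add: algebra_simps)
  next
    case (coord_cnj k m f j)
    then show ?case using bipoly.coord_cnj[of k m "\<lambda>z. c * f z" j] by (simp add: algebra_simps)
  qed
  then show ?case by (rule bipoly_mono) auto
next
  case (add k m f h)
  then show ?case using bipoly.add[of "k + k'" "m + m'" "\<lambda>z. f z * g z" "\<lambda>z. h z * g z"]
    by (simp add: algebra_simps)
next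
  case (coord k m f j)
  then show ?case using bipoly.coord[of "k + k'" "m + m'" "\<lambda>z. f z * g z" j] by (simp add: algebra_simps)
next
  case (coord_cnj k m f j)
  then show ?case using bipoly.coord_cnj[of "k + k'" "m + m'" "\<lambda>z. f z * g z" j] by (simp add: algebra_simps)
qed

lemma bipoly_cmult: "bipoly k m f \<Longrightarrow> bipoly k m (\<lambda>z. c * f z)"
  using bipoly_mult[OF bipoly.const[of 0 0 c], of k m f] by simp

lemma bipoly_diff: "bipoly k m f \<Longrightarrow> bipoly k m g \<Longrightarrow> bipoly k m (\<lambda>z. f z - g z)"
  using bipoly.add[of k m f "\<lambda>z. - 1 * g z"] bipoly_cmult[of k m g "- 1"] by simp

lemma bipoly_sum: "(\<And>i. i \<in> I \<Longrightarrow> bipoly k m (f i)) \<Longrightarrow> bipoly k m (\<lambda>z. \<Sum>i\<in>I. f i z)"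
  by (induction I rule: infinite_finite_induct) (auto intro: bipoly.intros)

lemma bipoly_power: "bipoly k m f \<Longrightarrow> bipoly (e * k) (e * m) (\<lambda>z. f z ^ e)"
proof (induction e)
  case (Suc e)
  then show ?case using bipoly_mult[of k m f "e * k" "e * m" "\<lambda>z. f z ^ e"] by simp
qed (auto intro: bipoly.const)

text \<open>With \<open>m = 0\<close> this serves monomials in the coordinates, with
  \<open>m = 1\<close> monomials in their real and imaginary parts.\<close>

lemma bipoly_prod_power:
  assumes "\<And>i. i \<in> I \<Longrightarrow> bipoly 1 m (f i)"
  shows "bipoly (\<Sum>i\<in>I. \<gamma> i) ((\<Sum>i\<in>I. \<gamma> i) * m) (\<lambda>z. \<Prod>i\<in>I. f i z ^ \<gamma> i)"
  using assms
proof (induction I rule: infinite_finite_induct)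
  case (insert i I)
  then have "bipoly (\<gamma> i * 1 + (\<Sum>i\<in>I. \<gamma> i)) (\<gamma> i * m + (\<Sum>i\<in>I. \<gamma> i) * m)
      (\<lambda>z. f i z ^ \<gamma> i * (\<Prod>i\<in>I. f i z ^ \<gamma> i))"
    by (intro bipoly_mult bipoly_power) auto
  then show ?case using insert by (simp add: algebra_simps)
qed (auto intro: bipoly.const)

lemma bipoly_coord: "bipoly 1 0 (\<lambda>z. z $ j)"
  using bipoly.coord[OF bipoly.const[of 0 0 1]] by simp

lemma bipoly_cnj_coord: "bipoly 1 1 (\<lambda>z. cnj (z $ j))"
  using bipoly.coord_cnj[OF bipoly.const[of 0 0 1]] by simp

lemma bipoly_Re: "bipoly 1 1 (\<lambda>z. complex_of_real (Re (z $ j)))"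
proof -
  have "bipoly 1 1 (\<lambda>z. 1/2 * (z $ j + cnj (z $ j)))"
    by (intro bipoly_cmult bipoly.add bipoly_cnj_coord bipoly_mono[OF bipoly_coord]) auto
  moreover have "(\<lambda>z. 1/2 * (z $ j + cnj (z $ j))) = (\<lambda>z. complex_of_real (Re (z $ j)))"
    by (auto simp: complex_eq_iff)
  ultimately show ?thesis by simp
qed

lemma bipoly_Im: "bipoly 1 1 (\<lambda>z. complex_of_real (Im (z $ j)))"
proof -
  have "bipoly 1 1 (\<lambda>z. - \<i>/2 * (z $ j - cnj (z $ j)))"
    by (intro bipoly_cmult bipoly_diff bipoly_cnj_coord bipoly_mono[OF bipoly_coord]) auto
  moreover have "(\<lambda>z. - \<i>/2 * (z $ j - cnj (z $ j))) = (\<lambda>z. complex_of_real (Im (z $ j)))"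
    by (auto simp: complex_eq_iff)
  ultimately show ?thesis by simp
qed

lemma vec_real_expansion:
  "z = (\<Sum>j\<in>UNIV. Re (z $ j) *\<^sub>R axis j 1 + Im (z $ j) *\<^sub>R axis j \<i>)" for z :: "complex ^ 'n"
proof -
  have "(\<Sum>j\<in>UNIV. Re (z $ j) *\<^sub>R axis j 1 + Im (z $ j) *\<^sub>R axis j \<i>) $ i
      = (\<Sum>j\<in>UNIV. if j = i then z $ i else 0)" for i
    unfolding sum_component by (intro sum.cong refl) (auto simp: axis_def complex_eq_iff)
  then show ?thesis by (simp add: vec_eq_iff)
qed

lemma bipoly_linear:
  fixes L :: "complex ^ 'n \<Rightarrow> complex"
  assumes "linear L"
  shows "bipoly 1 1 L"
proof -
  have "L z = (\<Sum>j\<in>UNIV. L (axis j 1) * complex_of_real (Re (z $ j))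
                        + L (axis j \<i>) * complex_of_real (Im (z $ j)))" for z
    by (subst vec_real_expansion[of z], simp only: linear_sum[OF assms] linear_add[OF assms]
        linear_scale[OF assms]) (simp add: scaleR_conv_of_real mult.commute)
  then have "L = (\<lambda>z. \<Sum>j\<in>UNIV. L (axis j 1) * complex_of_real (Re (z $ j))
                        + L (axis j \<i>) * complex_of_real (Im (z $ j)))" by blast
  moreover have "bipoly 1 1 (\<lambda>z. \<Sum>j\<in>UNIV. L (axis j 1) * complex_of_real (Re (z $ j))
                        + L (axis j \<i>) * complex_of_real (Im (z $ j)))"
    by (intro bipoly_sum bipoly.add bipoly_cmult bipoly_Re bipoly_Im)
  ultimately show ?thesis by simp
qed

text \<open>Settles the bottom case of degree counts that contain the truncated subtraction
  \<open>k - 1\<close>.\<close>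

lemma bipoly_degree_0: "bipoly k m f \<Longrightarrow> k = 0 \<Longrightarrow> \<exists>c. f = (\<lambda>z. c)"
  by (induction rule: bipoly.induct) auto

section \<open>Wirtinger derivatives\<close>

text \<open>Keeping \<open>s\<close> as a parameter proves each rule of differentiation for both
  Wirtinger operators at once.\<close>

definition wirtinger :: "complex \<Rightarrow> 'n \<Rightarrow> (complex ^ 'n \<Rightarrow> complex) \<Rightarrow> complex ^ 'n \<Rightarrow> complex" where
  "wirtinger s j f z =
     (frechet_derivative f (at z) (axis j 1) + s * frechet_derivative f (at z) (axis j \<i>)) / 2"

abbreviation "dz \<equiv> wirtinger (- \<i>)"
abbreviation "dbar \<equiv> wirtinger \<i>"

lemma wirtinger_eq:
  assumes "(f has_derivative D) (at z)"
  shows "wirtinger s j f z = (D (axis j 1) + s * D (axis j \<i>)) / 2"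
  using frechet_derivative_at[OF assms] by (simp add: wirtinger_def)

lemma wirtinger_cong:
  assumes "open S" "z \<in> S" "\<And>w. w \<in> S \<Longrightarrow> f w = g w" "f differentiable (at z)"
  shows "wirtinger s j f z = wirtinger s j g z"
proof -
  obtain D where D: "(f has_derivative D) (at z)" using assms(4) by (auto simp: differentiable_def)
  then have "(g has_derivative D) (at z)"
    using has_derivative_transform_within_open[OF D assms(1,2)] assms(3) by blast
  with D show ?thesis by (simp add: wirtinger_eq)
qed

lemma wirtinger_const [simp]: "wirtinger s j (\<lambda>z. c) z = 0"
  by (simp add: wirtinger_eq[OF has_derivative_const])

lemma wirtinger_add:
  assumes "f differentiable (at z)" "g differentiable (at z)"
  shows "wirtinger s j (\<lambda>w. f w + g w) z = wirtinger s j f z + wirtinger s j g z"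
proof -
  obtain D E where D: "(f has_derivative D) (at z)" and E: "(g has_derivative E) (at z)"
    using assms by (auto simp: differentiable_def)
  show ?thesis
    by (simp add: wirtinger_eq[OF D] wirtinger_eq[OF E] wirtinger_eq[OF has_derivative_add[OF D E]] field_simps)
qed

lemma wirtinger_mult:
  assumes "f differentiable (at z)" "g differentiable (at z)"
  shows "wirtinger s j (\<lambda>w. f w * g w) z = wirtinger s j f z * g z + f z * wirtinger s j g z"
proof -
  obtain D E where D: "(f has_derivative D) (at z)" and E: "(g has_derivative E) (at z)"
    using assms by (auto simp: differentiable_def)
  show ?thesis
    by (simp add: wirtinger_eq[OF D] wirtinger_eq[OF E] wirtinger_eq[OF has_derivative_mult[OF D E]] field_simps)
qed

lemma wirtinger_cmult:
  assumes "f differentiable (at z)"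
  shows "wirtinger s j (\<lambda>w. c * f w) z = c * wirtinger s j f z"
  using wirtinger_mult[OF differentiable_const[of c] assms] by simp

lemma has_derivative_cnj: "(f has_derivative D) F \<Longrightarrow> ((\<lambda>w. cnj (f w)) has_derivative (\<lambda>v. cnj (D v))) F"
  by (rule bounded_linear.has_derivative[OF bounded_linear_cnj])

lemma differentiable_cnj:
  "f differentiable (at z) \<Longrightarrow> (\<lambda>w. cnj (f w)) differentiable (at z)"
  by (auto simp: differentiable_def intro: has_derivative_cnj)

text \<open>Conjugation exchanges \<open>dz\<close> and \<open>dbar\<close>, so \<open>dz\<close>
  annihilates conjugates of holomorphic functions.\<close>

lemma wirtinger_cnj:
  assumes "f differentiable (at z)"
  shows "wirtinger s j (\<lambda>w. cnj (f w)) z = cnj (wirtinger (cnj s) j f z)"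
proof -
  obtain D where D: "(f has_derivative D) (at z)"
    using assms by (auto simp: differentiable_def)
  show ?thesis by (simp add: wirtinger_eq[OF D] wirtinger_eq[OF has_derivative_cnj[OF D]])
qed

lemma has_derivative_coord: "((\<lambda>z. z $ i) has_derivative (\<lambda>v. v $ i)) F"
  by (rule bounded_linear.has_derivative[OF bounded_linear_vec_nth has_derivative_ident])

lemma differentiable_coord: "(\<lambda>z. z $ i) differentiable (at z)"
  using has_derivative_coord by (auto simp: differentiable_def)

lemma wirtinger_coord: "wirtinger s j (\<lambda>z. z $ i) z = (if i = j then (1 + s * \<i>) / 2 else 0)"
  by (auto simp: wirtinger_eq[OF has_derivative_coord] axis_def)

lemma wirtinger_cnj_coord:
  "wirtinger s j (\<lambda>z. cnj (z $ i)) z = (if i = j then (1 - s * \<i>) / 2 else 0)"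
  by (simp add: wirtinger_cnj differentiable_coord wirtinger_coord)

lemma bipoly_differentiable: "bipoly k m f \<Longrightarrow> f differentiable (at z)"
  by (induction rule: bipoly.induct)
    (auto intro!: differentiable_mult differentiable_add differentiable_cnj differentiable_coord)

lemma bipoly_wirtinger: "bipoly k m f \<Longrightarrow> bipoly (k - 1) m (wirtinger s j f)"
proof (induction rule: bipoly.induct)
  case (const k m c)
  have "wirtinger s j (\<lambda>z. c) = (\<lambda>z. 0)" by (rule ext) simp
  then show ?case by (simp add: bipoly.const)
next
  case (add k m f g)
  then have "wirtinger s j (\<lambda>z. f z + g z) = (\<lambda>z. wirtinger s j f z + wirtinger s j g z)"
    by (intro ext wirtinger_add bipoly_differentiable)
  with add show ?case by (simp add: bipoly.add)
next
  case (coord k m f i)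
  have eq: "wirtinger s j (\<lambda>z. z $ i * f z)
      = (\<lambda>z. (if i = j then (1 + s * \<i>) / 2 else 0) * f z + z $ i * wirtinger s j f z)"
    by (rule ext, subst wirtinger_mult[OF differentiable_coord bipoly_differentiable[OF coord(1)]])
      (simp add: wirtinger_coord)
  \<comment> \<open>For \<open>k = 0\<close> the factor \<open>z $ i\<close> would push the bound to
    1, beyond \<open>Suc 0 - 1\<close>; but then \<open>f\<close> is constant and the term is
    0.\<close>
  have "bipoly k m (\<lambda>z. z $ i * wirtinger s j f z)"
  proof (cases k)
    case 0
    then obtain c where "f = (\<lambda>z. c)" using bipoly_degree_0[OF coord(1)] by blast
    then show ?thesis by (simp add: bipoly.const)
  qed (use bipoly.coord[OF coord(2)] in auto)
  then show ?case unfolding eq using coord(1)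
    by (intro bipoly.add bipoly_cmult) auto
next
  case (coord_cnj k m f i)
  have eq: "wirtinger s j (\<lambda>z. cnj (z $ i) * f z)
      = (\<lambda>z. (if i = j then (1 - s * \<i>) / 2 else 0) * f z + cnj (z $ i) * wirtinger s j f z)"
    by (rule ext, subst wirtinger_mult[OF differentiable_cnj[OF differentiable_coord] bipoly_differentiable[OF coord_cnj(1)]])
      (simp add: wirtinger_cnj_coord)
  have "bipoly k (Suc m) (\<lambda>z. cnj (z $ i) * wirtinger s j f z)"
  proof (cases k)
    case 0
    then obtain c where "f = (\<lambda>z. c)" using bipoly_degree_0[OF coord_cnj(1)] by blast
    then show ?thesis by (simp add: bipoly.const)
  qed (use bipoly.coord_cnj[OF coord_cnj(2)] in auto)
  then show ?case unfolding eq
    using bipoly_mono[OF coord_cnj(1), of k "Suc m"] by (intro bipoly.add bipoly_cmult) auto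
qed

lemma bipoly_holomorphic_dbar: "bipoly k m f \<Longrightarrow> m = 0 \<Longrightarrow> dbar j f z = 0"
proof (induction rule: bipoly.induct)
  case (add k m f g)
  then show ?case by (simp add: wirtinger_add bipoly_differentiable)
next
  case (coord k m f i)
  then show ?case by (simp add: wirtinger_mult bipoly_differentiable differentiable_coord wirtinger_coord)
qed auto

section \<open>Polynomials annihilated by dbar\<close>

definition antiholomorphic_euler :: "(complex ^ 'n \<Rightarrow> complex) \<Rightarrow> complex ^ 'n \<Rightarrow> complex" where
  "antiholomorphic_euler f z = (\<Sum>j\<in>UNIV. cnj (z $ j) * dbar j f z)"

text \<open>The monomial \<open>z\<^sup>\<alpha> \<zeta>\<^sup>\<beta>\<close>, with \<open>\<zeta>\<close> the conjugate of \<open>z\<close>, is an eigenfunction with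
  eigenvalue \<open>|\<beta>|\<close>, so subtracting \<open>Suc m\<close> kills the top antiholomorphic degree.\<close>
lemma bipoly_euler:
  "bipoly k l f \<Longrightarrow> l = Suc m \<Longrightarrow> bipoly k m (\<lambda>z. antiholomorphic_euler f z - of_nat l * f z)"
proof (induction arbitrary: m rule: bipoly.induct)
  case (const k l c)
  then show ?case by (simp add: antiholomorphic_euler_def bipoly.const)
next
  case (add k l f g)
  have "(\<lambda>z. antiholomorphic_euler (\<lambda>z. f z + g z) z - of_nat l * (f z + g z))
     = (\<lambda>z. (antiholomorphic_euler f z - of_nat l * f z) + (antiholomorphic_euler g z - of_nat l * g z))"
    using add(1,2) by (intro ext) (simp add: antiholomorphic_euler_def wirtinger_add bipoly_differentiable
        sum.distrib algebra_simps)
  with add show ?case by (auto intro!: bipoly.add)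
next
  case (coord k l f i)
  have "(\<lambda>z. antiholomorphic_euler (\<lambda>z. z $ i * f z) z - of_nat l * (z $ i * f z))
     = (\<lambda>z. z $ i * (antiholomorphic_euler f z - of_nat l * f z))"
  proof
    fix z
    have "dbar j (\<lambda>z. z $ i * f z) z = z $ i * dbar j f z" for j
      using coord(1) by (simp add: wirtinger_mult differentiable_coord wirtinger_coord bipoly_differentiable)
    then show "antiholomorphic_euler (\<lambda>z. z $ i * f z) z - of_nat l * (z $ i * f z)
       = z $ i * (antiholomorphic_euler f z - of_nat l * f z)"
      by (simp add: antiholomorphic_euler_def sum_distrib_left right_diff_distrib mult.left_commute)
  qed
  with coord show ?case by (auto intro!: bipoly.coord)
next
  case (coord_cnj k l f i)
  have *: "antiholomorphic_euler (\<lambda>z. cnj (z $ i) * f z) z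
      = cnj (z $ i) * f z + cnj (z $ i) * antiholomorphic_euler f z" for z
  proof -
    have "antiholomorphic_euler (\<lambda>z. cnj (z $ i) * f z) z
       = (\<Sum>j\<in>UNIV. (if i = j then cnj (z $ i) * f z else 0) + cnj (z $ i) * (cnj (z $ j) * dbar j f z))"
      unfolding antiholomorphic_euler_def using coord_cnj(1)
      by (intro sum.cong refl) (simp add: wirtinger_mult differentiable_coord differentiable_cnj
        wirtinger_cnj_coord bipoly_differentiable algebra_simps)
    then show ?thesis by (simp add: antiholomorphic_euler_def sum.distrib sum_distrib_left)
  qed
  have **: "(\<lambda>z. antiholomorphic_euler (\<lambda>z. cnj (z $ i) * f z) z - of_nat (Suc l) * (cnj (z $ i) * f z))
     = (\<lambda>z. cnj (z $ i) * (antiholomorphic_euler f z - of_nat l * f z))"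
    unfolding * by (simp add: algebra_simps)
  show ?case
  \<comment> \<open>The induction hypothesis speaks of successors only. For \<open>l = 0\<close> the
    factor \<open>f\<close> is holomorphic, so its Euler term and \<open>of_nat l * f z\<close> both
    vanish.\<close>
  proof (cases l)
    case 0
    have "antiholomorphic_euler f z = 0" for z
      unfolding antiholomorphic_euler_def by (simp add: bipoly_holomorphic_dbar[OF coord_cnj(1) 0])
    then show ?thesis unfolding ** using 0 by (simp add: bipoly.const)
  next
    case (Suc l')
    then show ?thesis unfolding ** using coord_cnj by (auto intro!: bipoly.coord_cnj)
  qed
qed

text \<open>On \<open>S\<close> the Euler term vanishes, so there \<open>f\<close> equals
  \<open>- inverse c\<close> times \<open>antiholomorphic_euler f - c * f\<close>, a polynomial of
  smaller antiholomorphic degree. Since \<open>S\<close> is open, this polynomial again has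
  vanishing \<open>dbar\<close> on \<open>S\<close>, and the descent continues without any
  comparison of coefficients.\<close>

lemma dbar_zero_imp_holomorphic_bipoly:
  assumes "open S" "bipoly k m f" "\<And>z j. z \<in> S \<Longrightarrow> dbar j f z = 0"
  shows "\<exists>h. bipoly k 0 h \<and> (\<forall>z\<in>S. f z = h z)"
  using assms(2,3)
proof (induction m arbitrary: f)
  case (Suc m)
  define c :: complex where "c = of_nat (Suc m)"
  have c: "c \<noteq> 0" unfolding c_def by (simp del: of_nat_Suc)
  define g where "g z = - inverse c * (antiholomorphic_euler f z - c * f z)" for z
  have g: "bipoly k m g"
    unfolding g_def c_def by (intro bipoly_cmult bipoly_euler[OF Suc.prems(1) refl])
  have eq: "f z = g z" if "z \<in> S" for z
    using that Suc.prems(2) c by (simp add: g_def antiholomorphic_euler_def)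
  have "dbar j g z = 0" if "z \<in> S" for z j
    using wirtinger_cong[OF assms(1) that eq bipoly_differentiable[OF Suc.prems(1)]] Suc.prems(2)[OF that]
    by simp
  from Suc.IH[OF g this] eq show ?case by auto
qed auto

section \<open>Holomorphic functions of several variables\<close>

text \<open>The hypothesis says that \<open>D\<close> commutes with multiplication by
  \<open>\<i>\<close> on each coordinate axis; expanding a vector along the axes extends this to all
  complex scalars.\<close>

lemma dbar_zero_complex_linear:
  fixes D :: "complex ^ 'n \<Rightarrow> complex"
  assumes D: "(f has_derivative D) (at z)" and 0: "\<And>j. dbar j f z = 0"
  shows "D (c *s v) = c * D v"
proof -
  have lin: "linear D" using D by (rule has_derivative_linear)
  have i: "D (axis j \<i>) = \<i> * D (axis j 1)" for j
  proof -
    have "D (axis j 1) + \<i> * D (axis j \<i>) = 0" using 0[of j] by (simp add: wirtinger_eq[OF D])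
    then have "\<i> * (D (axis j 1) + \<i> * D (axis j \<i>)) = 0" by simp
    then have "\<i> * D (axis j 1) - D (axis j \<i>) = 0" by (simp add: distrib_left)
    then show ?thesis by simp
  qed
  have D_eq: "D v = (\<Sum>j\<in>UNIV. v $ j * D (axis j 1))" for v
  proof -
    have "D v = (\<Sum>j\<in>UNIV. Re (v $ j) *\<^sub>R D (axis j 1) + Im (v $ j) *\<^sub>R D (axis j \<i>))"
      by (subst vec_real_expansion[of v], simp only: linear_sum[OF lin] linear_add[OF lin]
        linear_scale[OF lin])
    also have "\<dots> = (\<Sum>j\<in>UNIV. v $ j * D (axis j 1))"
      unfolding i by (intro sum.cong refl) (simp add: complex_eq_iff)
    finally show ?thesis .
  qed
  show ?thesis unfolding D_eq[of "c *s v"] D_eq[of v] by (simp add: sum_distrib_left mult.assoc)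
qed

lemma holomorphic_on_vec_dbar:
  assumes "holomorphic_on_vec f S" "z \<in> S"
  shows "dbar j f z = 0"
proof -
  obtain D where D: "(f has_derivative D) (at z)" "\<And>c v. D (c *s v) = c * D v"
    using assms unfolding holomorphic_on_vec_def by meson
  have "axis j \<i> = \<i> *s axis j 1" by (simp add: vec_eq_iff axis_def)
  then show ?thesis using D(2)[of \<i> "axis j 1"] by (simp add: wirtinger_eq[OF D(1)])
qed

lemma holomorphic_on_vec_differentiable:
  "holomorphic_on_vec f S \<Longrightarrow> z \<in> S \<Longrightarrow> f differentiable (at z)"
  by (auto simp: holomorphic_on_vec_def differentiable_def)

lemma holomorphic_on_vec_cong:
  assumes "open S" "\<And>z. z \<in> S \<Longrightarrow> f z = g z" "holomorphic_on_vec f S"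
  shows "holomorphic_on_vec g S"
  unfolding holomorphic_on_vec_def
proof
  fix z assume z: "z \<in> S"
  then obtain D where D: "(f has_derivative D) (at z)" "\<And>c v. D (c *s v) = c * D v"
    using assms(3) unfolding holomorphic_on_vec_def by meson
  then show "\<exists>D. (g has_derivative D) (at z) \<and> (\<forall>c v. D (c *s v) = c * D v)"
    using has_derivative_transform_within_open[OF D(1) assms(1) z assms(2)] by blast
qed

lemma bipoly_holomorphic: "bipoly k 0 f \<Longrightarrow> holomorphic_on_vec f S"
  unfolding holomorphic_on_vec_def
proof
  fix z assume f: "bipoly k 0 f"
  obtain D where D: "(f has_derivative D) (at z)"
    using bipoly_differentiable[OF f, of z] by (auto simp: differentiable_def)
  with dbar_zero_complex_linear[OF D bipoly_holomorphic_dbar[OF f refl]]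
  show "\<exists>D. (f has_derivative D) (at z) \<and> (\<forall>c v. D (c *s v) = c * D v)" by blast
qed

lemma holomorphic_on_vec_diff:
  assumes "holomorphic_on_vec f S" "holomorphic_on_vec g S"
  shows "holomorphic_on_vec (\<lambda>z. f z - g z) S"
  unfolding holomorphic_on_vec_def
proof
  fix z assume "z \<in> S"
  then obtain D E where "(f has_derivative D) (at z)" "\<And>c v. D (c *s v) = c * D v"
    "(g has_derivative E) (at z)" "\<And>c v. E (c *s v) = c * E v"
    using assms unfolding holomorphic_on_vec_def by meson
  then show "\<exists>D. ((\<lambda>z. f z - g z) has_derivative D) (at z) \<and> (\<forall>c v. D (c *s v) = c * D v)"
    by (intro exI[of _ "\<lambda>v. D v - E v"]) (auto intro: has_derivative_diff simp: algebra_simps)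
qed

section \<open>The operator \<open>F\<close>\<close>

definition fischer :: "(complex ^ 'n \<Rightarrow> complex) \<Rightarrow> (complex ^ 'n \<Rightarrow> complex) \<Rightarrow> complex ^ 'n \<Rightarrow> complex" where
  "fischer r q z = (\<Sum>j\<in>UNIV. dz j (\<lambda>w. r w * dbar j q w) z)"

text \<open>For \<open>N > 0\<close> the degree count is \<open>2 + (N - 1) - 1 = N\<close>, while
  the antiholomorphic bound overshoots to \<open>2 + N\<close> and is cut back by
  \<open>bipoly_diag\<close>. For \<open>N = 0\<close> truncated subtraction would yield 1, but then
  \<open>q\<close> is constant and \<open>fischer r q\<close> is 0.\<close>

lemma bipoly_fischer:
  assumes r: "bipoly 2 2 r" and q: "bipoly N N q"
  shows "bipoly N N (fischer r q)"
proof (cases N)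
  case 0
  then obtain c where "q = (\<lambda>z. c)" using bipoly_degree_0[OF q] by blast
  then show ?thesis by (simp add: fischer_def[abs_def] bipoly.const)
next
  case (Suc M)
  have "bipoly (2 + (N - 1) - 1) (2 + N) (dz j (\<lambda>w. r w * dbar j q w))" for j
    by (intro bipoly_wirtinger bipoly_mult r q)
  then have "bipoly N (2 + N) (fischer r q)"
    unfolding fischer_def[abs_def] using Suc by (intro bipoly_sum) simp
  then show ?thesis by (rule bipoly_diag)
qed

lemma fischer_add:
  assumes "bipoly 2 2 r" "bipoly N N p" "bipoly N N q"
  shows "fischer r (\<lambda>z. p z + q z) = (\<lambda>z. fischer r p z + fischer r q z)"
proof -
  have "dbar j (\<lambda>z. p z + q z) = (\<lambda>z. dbar j p z + dbar j q z)" for j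
    using assms by (intro ext wirtinger_add bipoly_differentiable)
  moreover have "dz j (\<lambda>w. r w * dbar j p w + r w * dbar j q w) z
      = dz j (\<lambda>w. r w * dbar j p w) z + dz j (\<lambda>w. r w * dbar j q w) z" for j z
    using assms by (intro wirtinger_add differentiable_mult bipoly_differentiable[OF bipoly_wirtinger]
        bipoly_differentiable)
  ultimately show ?thesis by (simp add: fischer_def[abs_def] sum.distrib distrib_left)
qed

lemma fischer_cmult:
  assumes "bipoly 2 2 r" "bipoly N N p"
  shows "fischer r (\<lambda>z. c * p z) = (\<lambda>z. c * fischer r p z)"
proof -
  have "dbar j (\<lambda>z. c * p z) = (\<lambda>z. c * dbar j p z)" for j
    using assms by (intro ext wirtinger_cmult bipoly_differentiable)
  moreover have "dz j (\<lambda>w. c * (r w * dbar j p w)) z = c * dz j (\<lambda>w. r w * dbar j p w) z" for j z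
    using assms by (intro wirtinger_cmult differentiable_mult bipoly_differentiable[OF bipoly_wirtinger]
        bipoly_differentiable)
  ultimately show ?thesis by (simp add: fischer_def[abs_def] sum_distrib_left mult.left_commute)
qed

section \<open>Integrals of derivatives of functions vanishing on the boundary\<close>

text \<open>A segment from a point of \<open>S\<close> to a point outside meets the frontier, where
  \<open>u\<close> vanishes; comparing \<open>u z\<close> with the value at that crossing point
  bounds it by the length of the segment.\<close>

lemma lipschitz_zero_extension:
  fixes u :: "'a::euclidean_space \<Rightarrow> 'b::real_normed_vector"
  assumes L: "L-lipschitz_on S u" and S: "closed S" and 0: "\<And>z. z \<in> frontier S \<Longrightarrow> u z = 0"
  shows "L-lipschitz_on UNIV (\<lambda>z. if z \<in> S then u z else 0)"
proof -
  have *: "norm (u z) \<le> L * dist z w" if z: "z \<in> S" and w: "w \<notin> S" for z w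
  proof -
    have "closed_segment z w \<inter> frontier S \<noteq> {}"
      using z w by (intro connected_Int_frontier convex_connected) auto
    then obtain p where p: "p \<in> closed_segment z w" "p \<in> frontier S" by blast
    have "p \<in> S" using p(2) S frontier_subset_closed by blast
    have "norm (u z) = dist (u z) (u p)" using 0[OF p(2)] by simp
    also have "\<dots> \<le> L * dist z p" using lipschitz_onD[OF L z \<open>p \<in> S\<close>] .
    also have "\<dots> \<le> L * dist z w"
      using lipschitz_on_nonneg[OF L] dist_in_closed_segment[of p z w] p(1)
      by (intro mult_left_mono) (auto simp: dist_commute)
    finally show ?thesis .
  qed
  show ?thesis
  proof (rule lipschitz_onI)
    fix z w :: 'a
    show "dist (if z \<in> S then u z else 0) (if w \<in> S then u w else 0) \<le> L * dist z w"
      using lipschitz_onD[OF L, of z w] *[of z w] *[of w z] lipschitz_on_nonneg[OF L]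
      by (auto simp: dist_commute)
  qed (rule lipschitz_on_nonneg[OF L])
qed

text \<open>By translation invariance the difference quotients of \<open>U\<close> have integral 0; the Lipschitz
  bound permits passing to the limit.\<close>
lemma lipschitz_directional_derivative_integral_0:
  fixes U :: "'a::euclidean_space \<Rightarrow> 'b::euclidean_space"
  assumes S: "open S" "bounded S" "convex S"
    and L: "L-lipschitz_on UNIV U" and 0: "\<And>z. z \<notin> S \<Longrightarrow> U z = 0"
    and D: "\<And>z. z \<in> S \<Longrightarrow> (U has_derivative D z) (at z)"
  shows "has_bochner_integral (lebesgue_on S) (\<lambda>z. D z v) 0"
proof -
  define t where "t n = inverse (real (Suc n))" for n
  have t: "0 < t n" "t n \<le> 1" "t \<longlonglongrightarrow> 0" for n
    using LIMSEQ_inverse_real_of_nat by (auto simp: t_def[abs_def] field_simps)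
  define g where "g n z = (U (z + t n *\<^sub>R v) - U z) /\<^sub>R t n" for n z
  \<comment> \<open>A Borel version of the directional derivative, extended by 0: nothing is known
    beforehand about the measurability of \<open>D z v\<close> in \<open>z\<close>, but limits of
    the Borel functions \<open>g n\<close> are Borel. On the frontier the quotients may fail to
    converge, hence the default value 0 there.\<close>
  define G where "G z = (if z \<in> frontier S then 0 else lim (\<lambda>n. g n z))" for z
  have U_cont: "continuous_on UNIV U" using L by (rule lipschitz_on_continuous_on)
  then have U_meas [measurable]: "U \<in> borel_measurable borel" by (rule borel_measurable_continuous_onI)
  have g_meas [measurable]: "g n \<in> borel_measurable borel" for n unfolding g_def by measurable
  have G_meas [measurable]: "G \<in> borel_measurable borel" unfolding G_def by measurable
  \<comment> \<open>Convexity of \<open>S\<close> is used here: its frontier is a null set.\<close>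
  have fr: "AE z in lborel. z \<notin> frontier S"
    using negligible_convex_frontier[OF S(3)]
    by (intro AE_not_in) (auto simp: negligible_iff_null_sets null_sets_completion_iff)
  have lim_in: "(\<lambda>n. g n z) \<longlonglongrightarrow> D z v" if z: "z \<in> S" for z
  proof -
    have "((\<lambda>h. (U (z + h *\<^sub>R v) - U z) /\<^sub>R h) \<longlongrightarrow> D z v) (at 0)"
    proof (cases "v = 0")
      case True
      have "D z 0 = 0" using D[OF z] by (simp add: linear_0 has_derivative_linear)
      then show ?thesis using True by simp
    next
      case v: False
      obtain e where e: "\<And>h. U (z + h) = U z + D z h + e h" "((\<lambda>h. norm (e h) / norm h) \<longlongrightarrow> 0) (at 0)"
        using D[OF z] unfolding has_derivative_iff_Ex by blast
      have lin: "D z (h *\<^sub>R v) = h *\<^sub>R D z v" for h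
        using D[OF z] by (simp add: linear_scale has_derivative_linear)
      have "((\<lambda>h. h *\<^sub>R v) \<longlongrightarrow> 0 *\<^sub>R v) (at (0::real))" by (intro tendsto_intros)
      moreover have "\<forall>\<^sub>F h in at (0::real). h *\<^sub>R v \<noteq> 0"
        using v by (auto simp: eventually_at_filter)
      ultimately have "filterlim (\<lambda>h. h *\<^sub>R v) (at 0) (at (0::real))" by (simp add: filterlim_at)
      from filterlim_compose[OF e(2) this]
      have "((\<lambda>h. norm (e (h *\<^sub>R v)) / norm (h *\<^sub>R v) * norm v) \<longlongrightarrow> 0 * norm v) (at (0::real))"
        by (intro tendsto_intros)
      moreover have "norm (e (h *\<^sub>R v)) / norm (h *\<^sub>R v) * norm v = norm (e (h *\<^sub>R v) /\<^sub>R h)" for h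
        using v by (simp add: divide_inverse mult.commute)
      ultimately have "((\<lambda>h. e (h *\<^sub>R v) /\<^sub>R h) \<longlongrightarrow> 0) (at (0::real))"
        by (simp only: tendsto_norm_zero_iff mult_zero_left)
      then have "((\<lambda>h. D z v + e (h *\<^sub>R v) /\<^sub>R h) \<longlongrightarrow> D z v + 0) (at (0::real))" by (intro tendsto_intros)
      moreover have "\<forall>\<^sub>F h in at (0::real). D z v + e (h *\<^sub>R v) /\<^sub>R h = (U (z + h *\<^sub>R v) - U z) /\<^sub>R h"
        by (auto simp: eventually_at_filter e(1) lin scaleR_right_distrib)
      ultimately show ?thesis by (simp add: tendsto_cong)
    qed
    then show ?thesis unfolding g_def
      by (rule filterlim_compose) (use t in \<open>auto simp: filterlim_at intro!: always_eventually less_imp_neq[symmetric]\<close>)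
  qed
  have lim_out: "(\<lambda>n. g n z) \<longlonglongrightarrow> 0" if "z \<notin> closure S" for z
  proof -
    have "(\<lambda>n. z + t n *\<^sub>R v) \<longlonglongrightarrow> z + 0 *\<^sub>R v" by (intro tendsto_intros t)
    then have "\<forall>\<^sub>F n in sequentially. z + t n *\<^sub>R v \<in> - closure S"
      using that by (intro topological_tendstoD) auto
    then have "\<forall>\<^sub>F n in sequentially. g n z = 0"
    proof eventually_elim
      case (elim n)
      then have "z + t n *\<^sub>R v \<notin> S" "z \<notin> S" using that closure_subset by auto
      then show ?case by (simp add: g_def 0)
    qed
    then show ?thesis by (rule tendsto_eventually)
  qed
  have G_eq: "G z = indicator S z *\<^sub>R D z v" for z
  proof -
    have "S \<inter> frontier S = {}" using S(1) by (simp add: frontier_def interior_open)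
    moreover have "frontier S \<union> S = closure S"
      using S(1) closure_subset by (auto simp: frontier_def interior_open)
    ultimately consider "z \<in> frontier S" "z \<notin> S" | "z \<in> S" "z \<notin> frontier S"
      | "z \<notin> frontier S" "z \<notin> S" "z \<notin> closure S" by blast
    then show ?thesis
      by cases (auto simp: G_def limI[OF lim_in] limI[OF lim_out])
  qed
  have g_lim: "AE z in lborel. (\<lambda>n. g n z) \<longlonglongrightarrow> G z"
    using fr
  proof eventually_elim
    case (elim z)
    then show ?case using lim_in[of z] lim_out[of z] S(1)
      by (cases "z \<in> S") (auto simp: G_eq frontier_def interior_open)
  qed
  obtain R where R: "\<And>z. z \<in> S \<Longrightarrow> norm z \<le> R" using S(2) by (auto simp: bounded_iff)
  \<comment> \<open>Since \<open>t n \<le> 1\<close>, outside this ball neither \<open>z\<close> nor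
    \<open>z + t n *\<^sub>R v\<close> lies in \<open>S\<close>, so all the quotients vanish
    there.\<close>
  let ?B = "cball 0 (R + norm v) :: 'a set"
  have g_bound: "norm (g n z) \<le> indicator ?B z *\<^sub>R (L * norm v)" for n z
  proof (cases "z \<in> ?B")
    case True
    have "norm (g n z) \<le> L * norm v"
    proof -
      have "dist (U (z + t n *\<^sub>R v)) (U z) \<le> L * dist (z + t n *\<^sub>R v) z"
        by (rule lipschitz_onD[OF L]) auto
      then have "norm (U (z + t n *\<^sub>R v) - U z) \<le> L * (t n * norm v)"
        using t(1)[of n] by (simp add: dist_norm)
      moreover have "norm (g n z) = norm (U (z + t n *\<^sub>R v) - U z) / t n"
        using t(1)[of n] by (simp add: g_def divide_inverse mult.commute)
      ultimately have "t n * norm (g n z) \<le> t n * (L * norm v)"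
        using t(1)[of n] by (simp add: mult_ac)
      then show ?thesis using t(1)[of n] by (rule mult_left_le_imp_le)
    qed
    then show ?thesis using True by simp
  next
    case False
    then have z: "norm z > R + norm v" by simp
    have "norm z - norm (t n *\<^sub>R v) \<le> norm (z + t n *\<^sub>R v)" by (metis add.commute norm_diff_ineq)
    moreover have "norm (t n *\<^sub>R v) \<le> norm v"
      using t(1,2)[of n] by (simp add: mult_left_le_one_le)
    ultimately have "norm (z + t n *\<^sub>R v) > R" "norm z > R" using z norm_ge_zero[of v] by linarith+
    then have "z + t n *\<^sub>R v \<notin> S" "z \<notin> S" using R by force+
    then show ?thesis using False by (simp add: g_def 0)
  qed
  have dom: "integrable lborel (\<lambda>z. indicator ?B z *\<^sub>R (L * norm v))"
    by (intro integrable_real_indicator integrable_scaleR_left) (use emeasure_lborel_cball_finite in auto)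
  have int_U: "integrable lborel U"
  proof -
    have "bounded (U ` cball 0 R)"
      by (intro compact_imp_bounded compact_continuous_image continuous_on_subset[OF U_cont]) auto
    then obtain B where "\<forall>x\<in>U ` cball 0 R. norm x \<le> B" unfolding bounded_iff ..
    then have B: "norm (U z) \<le> B" if "norm z \<le> R" for z using that by simp
    have "norm (U z) \<le> indicator (cball 0 R) z *\<^sub>R B" for z
      using B[of z] R[of z] 0[of z] by (auto simp: indicator_def)
    moreover have "integrable lborel (\<lambda>z::'a. indicator (cball 0 R) z *\<^sub>R B)"
      by (intro integrable_real_indicator integrable_scaleR_left) (use emeasure_lborel_cball_finite in auto)
    moreover have "AE z in lborel. norm (U z) \<le> norm (indicator (cball 0 R) z *\<^sub>R B)"
      using calculation(1) by (intro AE_I2) (metis abs_ge_self order_trans real_norm_def)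
    ultimately show ?thesis
      by (intro Bochner_Integration.integrable_bound[of lborel "\<lambda>z. indicator (cball 0 R) z *\<^sub>R B" U]) auto
  qed
  have shift: "has_bochner_integral lborel (\<lambda>z. U (z + c)) (integral\<^sup>L lborel U)" for c
  proof -
    have "has_bochner_integral (distr lborel borel ((+) c)) U (integral\<^sup>L lborel U)"
      unfolding lborel_distr_plus using int_U by (rule has_bochner_integral_integrable)
    then show ?thesis
      by (simp add: has_bochner_integral_iff integrable_distr_eq integral_distr add.commute)
  qed
  have g_int: "integral\<^sup>L lborel (g n) = 0" for n
  proof -
    have "has_bochner_integral lborel (\<lambda>z. U (z + t n *\<^sub>R v) - U (z + 0)) (integral\<^sup>L lborel U - integral\<^sup>L lborel U)"
      by (intro has_bochner_integral_diff shift)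
    then have "has_bochner_integral lborel (g n) ((integral\<^sup>L lborel U - integral\<^sup>L lborel U) /\<^sub>R t n)"
      unfolding g_def by (intro has_bochner_integral_scaleR_right) simp
    then show ?thesis by (simp add: has_bochner_integral_iff)
  qed
  have "integrable lborel G" and "(\<lambda>n. integral\<^sup>L lborel (g n)) \<longlonglongrightarrow> integral\<^sup>L lborel G"
    using integrable_dominated_convergence[OF _ _ dom g_lim] integral_dominated_convergence[OF _ _ dom g_lim] g_bound
    by simp_all
  then have "has_bochner_integral lborel G 0"
    by (simp add: g_int has_bochner_integral_iff LIMSEQ_const_iff)
  \<comment> \<open>Passing to the completed measure keeps the integral because \<open>G\<close> is
    Borel.\<close>
  then have "has_bochner_integral lebesgue G 0"
    by (simp add: has_bochner_integral_iff integrable_completion integral_completion)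
  then show ?thesis
    using S(1) by (subst has_bochner_integral_restrict_space) (simp_all add: G_eq[abs_def])
qed

text \<open>Turns almost everywhere into everywhere: by continuity the set where \<open>f\<close> is
  nonzero is open, and a nonempty open set is not a null set.\<close>

lemma nonneg_integral_0_imp_0:
  fixes f :: "'a::euclidean_space \<Rightarrow> real"
  assumes S: "open S" and f: "continuous_on S f" "\<And>z. z \<in> S \<Longrightarrow> 0 \<le> f z"
    and int: "has_bochner_integral (lebesgue_on S) f 0" and z: "z \<in> S"
  shows "f z = 0"
proof -
  have "AE z in lebesgue_on S. 0 \<le> f z" using f(2) by (intro AE_I2) simp
  then have "AE z in lebesgue_on S. f z = 0"
    using int integral_nonneg_eq_0_iff_AE[of "lebesgue_on S" f] by (simp add: has_bochner_integral_iff)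
  then have "AE z in lebesgue. z \<in> S \<longrightarrow> f z = 0"
    using S by (subst (asm) AE_restrict_space_iff) auto
  moreover have op: "open {z\<in>S. f z \<noteq> 0}"
  proof -
    have "open (S \<inter> f -` (- {0}))"
      using S f(1) by (intro continuous_open_preimage) auto
    moreover have "S \<inter> f -` (- {0}) = {z\<in>S. f z \<noteq> 0}" by auto
    ultimately show ?thesis by simp
  qed
  ultimately have "{z\<in>S. f z \<noteq> 0} \<in> null_sets lebesgue"
    by (intro AE_iff_null_sets[THEN iffD2]) auto
  then have "\<not> {z\<in>S. f z \<noteq> 0} \<noteq> {}"
    using open_not_negligible[OF op] by (metis negligible_iff_null_sets)
  then show ?thesis using z by auto
qed

section \<open>Lipschitz bounds for polynomials and holomorphic functions\<close>

lemma lipschitz_on_mult: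
  fixes f g :: "'a::heine_borel \<Rightarrow> complex"
  assumes S: "bounded S" and f: "\<exists>L. L-lipschitz_on S f" and g: "\<exists>L. L-lipschitz_on S g"
  shows "\<exists>L. L-lipschitz_on S (\<lambda>z. f z * g z)"
proof -
  obtain L M where L: "L-lipschitz_on S f" and M: "M-lipschitz_on S g" using f g by blast
  have "bounded (f ` S)" "bounded (g ` S)"
    using L M S by (auto intro: bounded_uniformly_continuous_image lipschitz_on_uniformly_continuous)
  then obtain A B where A: "\<And>z. z \<in> S \<Longrightarrow> norm (f z) \<le> A" "0 < A" and B: "\<And>z. z \<in> S \<Longrightarrow> norm (g z) \<le> B" "0 < B"
    unfolding bounded_pos by (metis imageI)
  have "(L * B + A * M)-lipschitz_on S (\<lambda>z. f z * g z)"
  proof (rule lipschitz_onI)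
    fix z w assume z: "z \<in> S" and w: "w \<in> S"
    have "dist (f z * g z) (f w * g w) = norm ((f z - f w) * g z + f w * (g z - g w))"
      by (simp add: dist_norm algebra_simps)
    also have "\<dots> \<le> norm (f z - f w) * norm (g z) + norm (f w) * norm (g z - g w)"
      by (metis norm_mult norm_triangle_ineq)
    also have "\<dots> \<le> (L * dist z w) * B + A * (M * dist z w)"
      using A(1)[OF w] B(1)[OF z] A(2) B(2) lipschitz_onD[OF L z w] lipschitz_onD[OF M z w]
      by (intro add_mono mult_mono) (auto simp: dist_norm intro: order_trans[OF norm_ge_zero])
    finally show "dist (f z * g z) (f w * g w) \<le> (L * B + A * M) * dist z w" by (simp add: algebra_simps)
  qed (use A(2) B(2) lipschitz_on_nonneg[OF L] lipschitz_on_nonneg[OF M] in simp)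
  then show ?thesis ..
qed

lemma lipschitz_on_cnj:
  assumes "\<exists>L. L-lipschitz_on S f"
  shows "\<exists>L. L-lipschitz_on S (\<lambda>z. cnj (f z))"
proof -
  have "dist (cnj a) (cnj b) = dist a b" for a b
    by (simp add: dist_norm flip: complex_cnj_diff)
  with assms show ?thesis by (simp add: lipschitz_on_def)
qed

lemma bipoly_lipschitz:
  assumes "bounded S"
  shows "bipoly k m f \<Longrightarrow> \<exists>L. L-lipschitz_on S f"
proof (induction rule: bipoly.induct)
  case const
  show ?case using lipschitz_on_constant by blast
next
  case add
  then show ?case using lipschitz_on_add by blast
next
  case (coord k m f j)
  have "1-lipschitz_on S (\<lambda>z. z $ j)"
    by (rule lipschitz_onI) (auto simp: dist_vec_nth_le)
  with coord assms show ?case by (intro lipschitz_on_mult) auto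
next
  case (coord_cnj k m f j)
  have "1-lipschitz_on S (\<lambda>z. z $ j)"
    by (rule lipschitz_onI) (auto simp: dist_vec_nth_le)
  with coord_cnj assms show ?case by (intro lipschitz_on_mult lipschitz_on_cnj) auto
qed

lemma bipoly_continuous_on: "bipoly k m f \<Longrightarrow> continuous_on S f"
  by (intro differentiable_imp_continuous_on differentiable_on_subset[of f UNIV S])
    (auto simp: differentiable_on_def bipoly_differentiable)

lemma bipoly_bounded:
  assumes "bounded S" "bipoly k m f"
  shows "\<exists>B. \<forall>z\<in>S. norm (f z) \<le> B"
proof -
  have "bounded (f ` S)"
    using bipoly_lipschitz[OF assms] assms(1)
    by (auto intro: bounded_uniformly_continuous_image lipschitz_on_uniformly_continuous)
  then show ?thesis by (auto simp: bounded_iff)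
qed

lemma norm_vector_scalar_mult: "norm (c *s v) = norm c * norm v" for v :: "complex ^ 'n"
  by (simp add: norm_vec_def norm_mult L2_set_right_distrib)

text \<open>On the complex line through \<open>z\<close> in direction \<open>v\<close> this is the
  one-variable Cauchy inequality. The radius \<open>d = e / norm v\<close> is the one for which the
  disc in the parameter is mapped into \<open>cball z e\<close>.\<close>

lemma holomorphic_on_vec_derivative_bound:
  assumes h: "holomorphic_on_vec h \<Omega>" and D: "(h has_derivative D) (at z)"
    and e: "0 < e" "cball z e \<subseteq> \<Omega>" and M: "\<And>w. w \<in> cball z e \<Longrightarrow> norm (h w) \<le> M"
  shows "norm (D v) \<le> M / e * norm v"
proof (cases "v = 0")
  case True
  then show ?thesis using D by (simp add: linear_0 has_derivative_linear)
next
  case v: False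
  define d where "d = e / norm v"
  have d: "0 < d" using e v by (simp add: d_def)
  define f where "f t = h (z + t *s v)" for t
  have in_ball: "z + t *s v \<in> cball z e" if "t \<in> cball 0 d" for t
    using that v by (simp add: dist_norm norm_vector_scalar_mult d_def field_simps)
  have der: "(f has_field_derivative D' v) (at t)"
    if D': "(h has_derivative D') (at (z + t *s v))" "\<And>c v. D' (c *s v) = c * D' v" for t D'
  proof -
    have "((\<lambda>t. z + t *s v) has_derivative (\<lambda>s. s *s v)) (at t)"
    proof -
      have "linear (\<lambda>s::complex. s *s v)"
        by (intro linearI) (auto simp: vec_eq_iff algebra_simps)
      then have "((\<lambda>t. t *s v) has_derivative (\<lambda>s. s *s v)) (at t)"
        by (intro bounded_linear_imp_has_derivative) (simp add: linear_conv_bounded_linear)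
      from has_derivative_add[OF has_derivative_const[of z] this] show ?thesis by simp
    qed
    from has_derivative_compose[OF this D'(1)]
    have "((\<lambda>t. h (z + t *s v)) has_derivative (\<lambda>s. s * D' v)) (at t)" by (simp add: D'(2))
    also have "(\<lambda>s. s * D' v) = (*) (D' v)" by (simp add: fun_eq_iff mult.commute)
    finally show ?thesis unfolding has_field_derivative_def f_def .
  qed
  have hol: "f holomorphic_on cball 0 d"
  proof (rule holomorphic_onI)
    fix t :: complex assume "t \<in> cball 0 d"
    then have "z + t *s v \<in> \<Omega>" using in_ball e by blast
    then obtain D' where "(h has_derivative D') (at (z + t *s v))" "\<And>c v. D' (c *s v) = c * D' v"
      using h unfolding holomorphic_on_vec_def by meson
    from der[OF this] show "f field_differentiable (at t within cball 0 d)"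
      by (auto simp: field_differentiable_def intro: has_field_derivative_at_within)
  qed
  have "norm ((deriv ^^ 1) f 0) \<le> fact 1 * M / d ^ 1"
  proof (rule Cauchy_inequality)
    show "f holomorphic_on ball 0 d" using hol ball_subset_cball by (rule holomorphic_on_subset)
    show "continuous_on (cball 0 d) f" using hol by (rule holomorphic_on_imp_continuous_on)
    fix t :: complex assume "norm (0 - t) = d"
    then show "norm (f t) \<le> M" unfolding f_def by (intro M in_ball) simp
  qed (rule d)
  moreover have "deriv f 0 = D v"
  proof -
    have "D (c *s v) = c * D v" for c v
    proof (rule dbar_zero_complex_linear[OF D])
      have "z \<in> \<Omega>" using e by auto
      then show "dbar j h z = 0" for j using h by (intro holomorphic_on_vec_dbar)
    qed
    moreover have "z + 0 *s v = z" by (simp add: vec_eq_iff)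
    ultimately have "(f has_field_derivative D v) (at 0)" using D by (intro der) simp_all
    then show ?thesis by (rule DERIV_imp_deriv)
  qed
  ultimately show ?thesis by (simp add: d_def)
qed

lemma holomorphic_on_vec_continuous_on: "holomorphic_on_vec f S \<Longrightarrow> continuous_on S f"
  by (auto intro!: continuous_at_imp_continuous_on differentiable_imp_continuous_within
      holomorphic_on_vec_differentiable)

text \<open>\<open>h\<close> may be unbounded near the boundary of \<open>\<Omega>\<close>, but it
  is bounded on a closed neighbourhood of \<open>K\<close> of some radius \<open>e\<close>. The
  Cauchy estimate then bounds its derivative on \<open>K\<close> by \<open>M / e\<close>, and
  convexity of \<open>K\<close> allows the mean value inequality.\<close>

lemma holomorphic_on_vec_lipschitz:
  assumes h: "holomorphic_on_vec h \<Omega>" and "open \<Omega>" and K: "compact K" "convex K" "K \<subseteq> \<Omega>"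
  shows "\<exists>L. L-lipschitz_on K h"
proof -
  obtain e where e: "0 < e" "(\<Union>x\<in>K. cball x e) \<subseteq> \<Omega>"
    using compact_subset_open_imp_cball_epsilon_subset[OF K(1) \<open>open \<Omega>\<close> K(3)] by blast
  \<comment> \<open>The union of the balls is written as a sum of two compact sets, which makes its
    compactness evident.\<close>
  let ?K = "{x + y | x y. x \<in> K \<and> y \<in> cball 0 e}"
  have K_eq: "?K = (\<Union>x\<in>K. cball x e)"
  proof (intro set_eqI iffI)
    fix w assume "w \<in> (\<Union>x\<in>K. cball x e)"
    then obtain x where "x \<in> K" "w \<in> cball x e" by blast
    then have "x \<in> K" "w - x \<in> cball 0 e" "w = x + (w - x)" by (auto simp: dist_norm norm_minus_commute)
    then show "w \<in> ?K" by blast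
  next
    fix w assume "w \<in> ?K"
    then obtain x y where "x \<in> K" "norm y \<le> e" "w = x + y" by auto
    then show "w \<in> (\<Union>x\<in>K. cball x e)" by (intro UN_I[of x]) (auto simp: dist_norm)
  qed
  have "compact ?K" using K(1) by (intro compact_sums) auto
  moreover have "continuous_on ?K h"
    using holomorphic_on_vec_continuous_on[OF h] e(2) unfolding K_eq by (rule continuous_on_subset)
  ultimately have "bounded (h ` ?K)" by (intro compact_imp_bounded compact_continuous_image)
  then obtain M where M: "0 < M" "\<And>w. w \<in> ?K \<Longrightarrow> norm (h w) \<le> M" unfolding bounded_pos by blast
  have "\<forall>z\<in>K. (h has_derivative frechet_derivative h (at z)) (at z within K)"
    using holomorphic_on_vec_differentiable[OF h] K(3)
    by (metis frechet_derivative_works has_derivative_at_withinI subsetD)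
  moreover have "onorm (frechet_derivative h (at z)) \<le> M / e" if z: "z \<in> K" for z
  proof (rule onorm_le, rule holomorphic_on_vec_derivative_bound[OF h])
    show "(h has_derivative frechet_derivative h (at z)) (at z)"
      using holomorphic_on_vec_differentiable[OF h] K(3) z by (metis frechet_derivative_works subsetD)
    show "cball z e \<subseteq> \<Omega>" using e z by blast
    show "norm (h w) \<le> M" if "w \<in> cball z e" for w
      using that z by (intro M(2), unfold K_eq) blast
  qed (rule e)
  ultimately have "norm (h z - h w) \<le> M / e * norm (z - w)" if "z \<in> K" "w \<in> K" for z w
    using that by (intro differentiable_bound[OF K(2)]) auto
  then have "(M / e)-lipschitz_on K h"
    using M e by (intro lipschitz_onI) (auto simp: dist_norm)
  then show ?thesis ..
qed

lemma integrable_mult_cnj: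
  fixes f g :: "'a \<Rightarrow> complex"
  assumes [measurable]: "f \<in> borel_measurable M" "g \<in> borel_measurable M"
    and "integrable M (\<lambda>z. (cmod (f z))\<^sup>2)" "integrable M (\<lambda>z. (cmod (g z))\<^sup>2)"
  shows "integrable M (\<lambda>z. f z * cnj (g z))"
proof (rule Bochner_Integration.integrable_bound)
  show "integrable M (\<lambda>z. (cmod (f z))\<^sup>2 + (cmod (g z))\<^sup>2)" using assms by simp
  have "cmod (f z * cnj (g z)) \<le> norm ((cmod (f z))\<^sup>2 + (cmod (g z))\<^sup>2)" for z
  proof -
    have "2 * (cmod (f z) * cmod (g z)) \<le> (cmod (f z))\<^sup>2 + (cmod (g z))\<^sup>2"
      using sum_squares_bound[of "cmod (f z)" "cmod (g z)"] by simp
    moreover have "0 \<le> cmod (f z) * cmod (g z)" by simp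
    ultimately have "cmod (f z) * cmod (g z) \<le> (cmod (f z))\<^sup>2 + (cmod (g z))\<^sup>2" by linarith
    then show ?thesis by (simp add: norm_mult)
  qed
  then show "AE z in M. cmod (f z * cnj (g z)) \<le> norm ((cmod (f z))\<^sup>2 + (cmod (g z))\<^sup>2)" by simp
  have [measurable]: "cnj \<in> borel_measurable borel" by (intro borel_measurable_continuous_onI continuous_intros)
  show "(\<lambda>z. f z * cnj (g z)) \<in> borel_measurable M" by measurable
qed

section \<open>Concentric ellipsoids and orthogonality of the range of \<open>F\<close>\<close>

locale affine_ball =
  fixes A :: "complex ^ 'n \<Rightarrow> complex ^ 'n" and a :: "complex ^ 'n"
  assumes linear_A: "linear A" and bij_A: "bij A"
begin

definition ellipsoid_norm :: "complex ^ 'n \<Rightarrow> real" where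
  "ellipsoid_norm z = norm (inv A (z - a))"

definition E :: "real \<Rightarrow> (complex ^ 'n) set" where
  "E \<rho> = {z. ellipsoid_norm z < \<rho>}"

text \<open>The defining functions of the concentric ellipsoids differ only by constants, which is
  what makes the limit from smaller ellipsoids to \<open>E 1\<close> tractable.\<close>

definition r :: "real \<Rightarrow> complex ^ 'n \<Rightarrow> complex" where
  "r \<rho> z = complex_of_real ((ellipsoid_norm z)\<^sup>2 - \<rho>\<^sup>2)"

lemma linear_inv_A: "linear (inv A)"
  using linear_A bij_is_inj[OF bij_A] by (simp add: inj_linear_imp_inv_linear linear_linear)

lemma E_eq_image: "E \<rho> = (\<lambda>v. a + A v) ` ball 0 \<rho>"
proof (intro set_eqI iffI)
  fix z assume "z \<in> E \<rho>"
  then show "z \<in> (\<lambda>v. a + A v) ` ball 0 \<rho>"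
    by (intro image_eqI[of _ _ "inv A (z - a)"])
      (auto simp: E_def ellipsoid_norm_def bij_is_surj[OF bij_A] surj_f_inv_f)
qed (auto simp: E_def ellipsoid_norm_def inv_f_f[OF bij_is_inj[OF bij_A]])

lemma continuous_on_ellipsoid_norm: "continuous_on S ellipsoid_norm"
  unfolding ellipsoid_norm_def
  by (intro continuous_on_norm continuous_on_compose2[OF linear_continuous_on[of "inv A" UNIV]]
      continuous_intros) (use linear_inv_A in \<open>auto simp: linear_conv_bounded_linear\<close>)

lemma open_E: "open (E \<rho>)"
  unfolding E_def by (intro open_Collect_less continuous_on_ellipsoid_norm continuous_intros)

lemma E_eq_translation: "E \<rho> = (+) a ` A ` ball 0 \<rho>"
  by (simp add: E_eq_image image_image)

lemma bounded_E: "bounded (E \<rho>)"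
  unfolding E_eq_translation
  by (intro bounded_translation bounded_linear_image) (use linear_A in \<open>auto simp: linear_conv_bounded_linear\<close>)

lemma convex_E: "convex (E \<rho>)"
  unfolding E_eq_translation by (intro convex_translation convex_linear_image linear_A convex_ball)

lemma closure_E_subset: "closure (E \<rho>) \<subseteq> {z. ellipsoid_norm z \<le> \<rho>}"
  by (intro closure_minimal closed_Collect_le continuous_on_ellipsoid_norm continuous_intros) (auto simp: E_def)

lemma closure_E_subset_E: "\<rho> < \<sigma> \<Longrightarrow> closure (E \<rho>) \<subseteq> E \<sigma>"
  using closure_E_subset[of \<rho>] by (auto simp: E_def)

lemma r_frontier: "z \<in> frontier (E \<rho>) \<Longrightarrow> r \<rho> z = 0"
  using closure_E_subset[of \<rho>] open_E[of \<rho>]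
  by (auto simp: frontier_def interior_open E_def r_def)

text \<open>The squared norm of \<open>inv A (z - a)\<close> is a sum of squared moduli of its
  components. These are only real affine in \<open>z\<close>, so each has bidegree (1,1), and so
  does its conjugate; this covers ellipsoids that are not given by a complex-Hermitian form.\<close>

lemma bipoly_r: "bipoly 2 2 (r \<rho>)"
proof -
  let ?w = "\<lambda>j z. inv A z $ j - inv A a $ j"
  have lin: "linear (\<lambda>z. inv A z $ j)" "linear (\<lambda>z. cnj (inv A z $ j))" for j
    using linear_inv_A by (auto intro!: linearI simp: linear_add linear_scale)
  have "bipoly (1 + 1) (1 + 1) (\<lambda>z. ?w j z * (cnj (inv A z $ j) - cnj (inv A a $ j)))" for j
    by (intro bipoly_mult bipoly_diff bipoly_linear lin bipoly.const)
  then have "bipoly 2 2 (\<lambda>z. (\<Sum>j\<in>UNIV. ?w j z * (cnj (inv A z $ j) - cnj (inv A a $ j)))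
      - complex_of_real (\<rho>\<^sup>2))"
    by (intro bipoly_diff bipoly_sum bipoly.const) (simp add: numeral_2_eq_2)
  moreover have "(\<lambda>z. (\<Sum>j\<in>UNIV. ?w j z * (cnj (inv A z $ j) - cnj (inv A a $ j)))
      - complex_of_real (\<rho>\<^sup>2)) = r \<rho>"
  proof
    fix z
    have "(ellipsoid_norm z)\<^sup>2 = (\<Sum>j\<in>UNIV. (cmod (?w j z))\<^sup>2)"
      by (simp add: ellipsoid_norm_def norm_vec_def L2_set_def sum_nonneg linear_diff[OF linear_inv_A])
    then show "(\<Sum>j\<in>UNIV. ?w j z * (cnj (inv A z $ j) - cnj (inv A a $ j))) - complex_of_real (\<rho>\<^sup>2)
        = r \<rho> z"
      by (simp add: r_def complex_norm_square[symmetric] flip: complex_cnj_diff)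
  qed
  ultimately show ?thesis by simp
qed

text \<open>Integration by parts without boundary term: the factor \<open>r \<rho>\<close> makes the
  product vanish on the frontier, so its zero extension is Lipschitz on the whole space. The factor
  \<open>\<kappa>\<close> will be the conjugate of a polynomial or of a Bergman function.\<close>

lemma wirtinger_integral_0:
  assumes \<psi>: "bipoly k m \<psi>" and \<kappa>: "\<exists>L. L-lipschitz_on (closure (E \<rho>)) \<kappa>"
    and \<kappa>_diff: "\<And>z. z \<in> E \<rho> \<Longrightarrow> \<kappa> differentiable (at z)"
  shows "has_bochner_integral (lebesgue_on (E \<rho>)) (wirtinger s j (\<lambda>w. r \<rho> w * \<psi> w * \<kappa> w)) 0"
proof -
  define u where "u w = r \<rho> w * \<psi> w * \<kappa> w" for w
  define U where "U z = (if z \<in> closure (E \<rho>) then u z else 0)" for z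
  have bdd: "bounded (closure (E \<rho>))" using bounded_E by (rule bounded_closure)
  have "\<exists>L. L-lipschitz_on (closure (E \<rho>)) u"
    unfolding u_def
    by (intro lipschitz_on_mult bdd bipoly_lipschitz[OF bdd bipoly_r] bipoly_lipschitz[OF bdd \<psi>] \<kappa>)
  then obtain L where L: "L-lipschitz_on (closure (E \<rho>)) u" ..
  have u_frontier: "u z = 0" if "z \<in> frontier (E \<rho>)" for z
    by (simp add: u_def r_frontier[OF that])
  \<comment> \<open>The zero extension starts from a closed set; taking the closure creates no new
    frontier points.\<close>
  have "frontier (closure (E \<rho>)) \<subseteq> frontier (E \<rho>)"
    unfolding frontier_def using interior_mono[OF closure_subset[of "E \<rho>"]] by auto
  then have U_lip: "L-lipschitz_on UNIV U"
    unfolding U_def using u_frontier by (intro lipschitz_zero_extension[OF L]) auto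
  have U_0: "U z = 0" if "z \<notin> E \<rho>" for z
    using that u_frontier[of z] open_E by (auto simp: U_def frontier_def interior_open)
  have U_der: "(U has_derivative frechet_derivative u (at z)) (at z)" if z: "z \<in> E \<rho>" for z
  proof -
    have "u differentiable (at z)"
      unfolding u_def by (intro differentiable_mult bipoly_differentiable[OF bipoly_r]
          bipoly_differentiable[OF \<psi>] \<kappa>_diff z)
    then have "(u has_derivative frechet_derivative u (at z)) (at z)"
      by (simp add: frechet_derivative_works)
    then show ?thesis
      using closure_subset[of "E \<rho>"]
      by (elim has_derivative_transform_within_open[OF _ open_E z]) (auto simp: U_def)
  qed
  have int: "has_bochner_integral (lebesgue_on (E \<rho>)) (\<lambda>z. frechet_derivative u (at z) v) 0" for v
    by (rule lipschitz_directional_derivative_integral_0[OF open_E bounded_E convex_E U_lip U_0 U_der])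
  have "has_bochner_integral (lebesgue_on (E \<rho>)) (wirtinger s j u) ((0 + s * 0) / 2)"
    unfolding wirtinger_def[abs_def]
    by (intro has_bochner_integral_divide has_bochner_integral_add has_bochner_integral_mult_right int)
  then show ?thesis by (simp add: u_def[abs_def])
qed

lemma fischer_zero_imp_dbar_zero:
  assumes q: "bipoly k m q" and 0: "\<And>z. z \<in> E 1 \<Longrightarrow> fischer (r 1) q z = 0" and z: "z \<in> E 1"
  shows "dbar j q z = 0"
proof -
  \<comment> \<open>This is \<open>- r 1\<close> times the squared length of the dbar gradient of
    \<open>q\<close>. The first factor is strictly positive on \<open>E 1\<close>, so the vanishing
    of \<open>f\<close> forces every \<open>dbar j q\<close> to vanish there.\<close>
  define f where "f z = (1 - (ellipsoid_norm z)\<^sup>2) * (\<Sum>j\<in>UNIV. (cmod (dbar j q z))\<^sup>2)" for z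
  have dq: "bipoly (k - 1) m (dbar j q)" for j using q by (rule bipoly_wirtinger)
  have norm_lt_1: "0 < 1 - (ellipsoid_norm z)\<^sup>2" if "z \<in> E 1" for z
    using that by (simp add: E_def ellipsoid_norm_def abs_square_less_1)
  have "bounded (closure (E 1))" using bounded_E by (rule bounded_closure)
  then have "has_bochner_integral (lebesgue_on (E 1)) (dz j (\<lambda>w. r 1 w * dbar j q w * cnj (q w))) 0" for j
    using q by (intro wirtinger_integral_0[OF dq] lipschitz_on_cnj bipoly_lipschitz differentiable_cnj
        bipoly_differentiable) auto
  then have "has_bochner_integral (lebesgue_on (E 1))
      (\<lambda>z. \<Sum>j\<in>UNIV. dz j (\<lambda>w. r 1 w * dbar j q w * cnj (q w)) z) (\<Sum>j\<in>(UNIV::'n set). 0)"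
    by (intro has_bochner_integral_sum)
  also have "?this \<longleftrightarrow> has_bochner_integral (lebesgue_on (E 1)) (\<lambda>z. - complex_of_real (f z)) 0"
  proof (rule has_bochner_integral_cong)
    fix z assume "z \<in> space (lebesgue_on (E 1))"
    then have z: "z \<in> E 1" by simp
    have "dz j (\<lambda>w. r 1 w * dbar j q w * cnj (q w)) z
        = dz j (\<lambda>w. r 1 w * dbar j q w) z * cnj (q z) + r 1 z * complex_of_real ((cmod (dbar j q z))\<^sup>2)" for j
    proof -
      have "dz j (\<lambda>w. cnj (q w)) z = cnj (dbar j q z)"
        by (simp add: wirtinger_cnj[OF bipoly_differentiable[OF q]])
      then show ?thesis
        using wirtinger_mult[OF bipoly_differentiable[OF bipoly_mult[OF bipoly_r dq]]
            differentiable_cnj[OF bipoly_differentiable[OF q]]]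
        unfolding complex_norm_square by (simp add: mult.assoc)
    qed
    then have "(\<Sum>j\<in>UNIV. dz j (\<lambda>w. r 1 w * dbar j q w * cnj (q w)) z)
       = fischer (r 1) q z * cnj (q z) + r 1 z * complex_of_real (\<Sum>j\<in>UNIV. (cmod (dbar j q z))\<^sup>2)"
      by (simp add: fischer_def sum.distrib sum_distrib_left sum_distrib_right)
    also have "\<dots> = - complex_of_real (f z)" by (simp add: 0[OF z] r_def f_def algebra_simps)
    finally show "(\<Sum>j\<in>UNIV. dz j (\<lambda>w. r 1 w * dbar j q w * cnj (q w)) z) = - complex_of_real (f z)" .
  qed auto
  finally have "has_bochner_integral (lebesgue_on (E 1)) (\<lambda>z. - Re (- complex_of_real (f z))) (- Re 0)"
    by (intro has_bochner_integral_minus has_bochner_integral_Re)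
  then have "has_bochner_integral (lebesgue_on (E 1)) f 0" by simp
  moreover have "continuous_on (E 1) f"
    unfolding f_def by (intro continuous_intros continuous_on_ellipsoid_norm bipoly_continuous_on[OF dq])
  moreover have "0 \<le> f z" if "z \<in> E 1" for z
    using norm_lt_1[OF that] by (simp add: f_def sum_nonneg)
  ultimately have "f z = 0" using z by (intro nonneg_integral_0_imp_0[OF open_E])
  then have "(\<Sum>j\<in>UNIV. (cmod (dbar j q z))\<^sup>2) = 0" using norm_lt_1[OF z] by (simp add: f_def)
  then show ?thesis by (subst (asm) sum_nonneg_eq_0_iff) auto
qed

lemma E_sets [measurable]: "E \<rho> \<in> sets lebesgue"
  using open_E by (simp add: borel_open)

lemma lmeasurable_E: "E \<rho> \<in> lmeasurable"
  using bounded_E open_E by (rule lmeasurable_open)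

text \<open>\<open>h\<close> need not be Lipschitz up to the boundary of \<open>E 1\<close>, so the
  integration by parts is carried out on \<open>E (\<rho> n)\<close> with its own defining function
  \<open>r (\<rho> n)\<close>. On it the conjugate of \<open>h\<close> is annihilated by
  \<open>dz j\<close> and is just carried along as a factor.\<close>

lemma dz_orthogonal:
  assumes \<psi>: "bipoly k m \<psi>" and h: "holomorphic_on_vec h (E 1)"
    and h_L2: "integrable (lebesgue_on (E 1)) (\<lambda>z. (cmod (h z))\<^sup>2)"
  shows "has_bochner_integral (lebesgue_on (E 1)) (\<lambda>z. dz j (\<lambda>w. r 1 w * \<psi> w) z * cnj (h z)) 0"
proof -
  define \<rho> where "\<rho> n = 1 - inverse (real (Suc n))" for n
  have \<rho>: "0 \<le> \<rho> n" "\<rho> n < 1" for n by (auto simp: \<rho>_def field_simps)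
  have \<rho>_lim: "\<rho> \<longlonglongrightarrow> 1"
    unfolding \<rho>_def[abs_def] using LIMSEQ_inverse_real_of_nat_add_minus[of 1] by simp
  have E_mono: "E (\<rho> n) \<subseteq> E 1" for n using \<rho>(2)[of n] by (auto simp: E_def)
  define P where "P = dz j (\<lambda>w. r 1 w * \<psi> w)"
  define Q where "Q = dz j \<psi>"
  have P: "bipoly (2 + k - 1) (2 + m) P" and Q: "bipoly (k - 1) m Q"
    unfolding P_def Q_def by (intro bipoly_wirtinger bipoly_mult bipoly_r \<psi>)+
  have P_meas: "continuous_on S P" and Q_meas: "continuous_on S Q" for S
    using P Q by (auto intro: bipoly_continuous_on)
  have h_cont: "continuous_on (E 1) h" using h by (rule holomorphic_on_vec_continuous_on)
  \<comment> \<open>The constant by which \<open>r (\<rho> n)\<close> exceeds \<open>r 1\<close>. It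
    contributes the error term \<open>c n * Q z\<close>, which tends to 0 with
    \<open>\<rho> n \<longlonglongrightarrow> 1\<close>.\<close>
  define c where "c n = complex_of_real (1 - (\<rho> n)\<^sup>2)" for n
  define s where "s n z = indicator (E (\<rho> n)) z *\<^sub>R ((P z + c n * Q z) * cnj (h z))" for n z
  define f where "f z = indicator (E 1) z *\<^sub>R (P z * cnj (h z))" for z
  have s_int: "has_bochner_integral lebesgue (s n) 0" for n
  proof -
    have "has_bochner_integral (lebesgue_on (E (\<rho> n))) (dz j (\<lambda>w. r (\<rho> n) w * \<psi> w * cnj (h w))) 0"
    proof (intro wirtinger_integral_0[OF \<psi>] lipschitz_on_cnj differentiable_cnj)
      show "\<exists>L. L-lipschitz_on (closure (E (\<rho> n))) h"
      proof (rule holomorphic_on_vec_lipschitz[OF h open_E])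
        show "compact (closure (E (\<rho> n)))" using bounded_E by (simp add: compact_closure)
        show "convex (closure (E (\<rho> n)))" using convex_E by (rule convex_closure)
        show "closure (E (\<rho> n)) \<subseteq> E 1" using \<rho> by (intro closure_E_subset_E)
      qed
      show "h differentiable at z" if "z \<in> E (\<rho> n)" for z
        using that E_mono by (intro holomorphic_on_vec_differentiable[OF h]) auto
    qed
    also have "?this \<longleftrightarrow> has_bochner_integral (lebesgue_on (E (\<rho> n))) (\<lambda>z. (P z + c n * Q z) * cnj (h z)) 0"
    proof (rule has_bochner_integral_cong)
      fix z assume "z \<in> space (lebesgue_on (E (\<rho> n)))"
      then have z: "z \<in> E 1" using E_mono[of n] by auto
      have hz: "h differentiable (at z)" using h z by (rule holomorphic_on_vec_differentiable)
      have "dz j (\<lambda>w. cnj (h w)) z = 0"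
        by (simp add: wirtinger_cnj[OF hz] holomorphic_on_vec_dbar[OF h z])
      moreover have "(\<lambda>w. r (\<rho> n) w * \<psi> w) = (\<lambda>w. r 1 w * \<psi> w + c n * \<psi> w)"
        by (auto simp: r_def c_def algebra_simps)
      moreover have "dz j (\<lambda>w. r 1 w * \<psi> w + c n * \<psi> w) z = P z + c n * Q z"
        unfolding P_def Q_def
        using wirtinger_add[OF bipoly_differentiable[OF bipoly_mult[OF bipoly_r \<psi>]]
            bipoly_differentiable[OF bipoly_cmult[OF \<psi>]]]
        by (simp add: wirtinger_cmult[OF bipoly_differentiable[OF \<psi>]])
      ultimately show "dz j (\<lambda>w. r (\<rho> n) w * \<psi> w * cnj (h w)) z = (P z + c n * Q z) * cnj (h z)"
        using wirtinger_mult[OF bipoly_differentiable[OF bipoly_mult[OF bipoly_r \<psi>]] differentiable_cnj[OF hz]]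
        by simp
    qed auto
    finally show ?thesis
      unfolding s_def by (subst (asm) has_bochner_integral_restrict_space) auto
  qed
  have s_lim: "(\<lambda>n. s n z) \<longlonglongrightarrow> f z" for z
  proof (cases "z \<in> E 1")
    case True
    then have "\<forall>\<^sub>F n in sequentially. ellipsoid_norm z < \<rho> n"
      using \<rho>_lim by (intro order_tendstoD) (auto simp: E_def)
    then have "\<forall>\<^sub>F n in sequentially. (P z + c n * Q z) * cnj (h z) = s n z"
      by eventually_elim (simp add: s_def E_def)
    moreover have "(\<lambda>n. (P z + c n * Q z) * cnj (h z)) \<longlonglongrightarrow> (P z + complex_of_real (1 - 1\<^sup>2) * Q z) * cnj (h z)"
      unfolding c_def by (intro tendsto_intros \<rho>_lim)
    ultimately show ?thesis using True by (simp add: f_def Lim_transform_eventually)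
  next
    case False
    then have "z \<notin> E (\<rho> n)" for n using E_mono by blast
    with False have "s n z = f z" for n by (simp add: s_def f_def)
    then show ?thesis by simp
  qed
  obtain BP BQ where BP: "\<forall>z\<in>E 1. norm (P z) \<le> BP" and BQ: "\<forall>z\<in>E 1. norm (Q z) \<le> BQ"
    using bipoly_bounded[OF bounded_E P] bipoly_bounded[OF bounded_E Q] by blast
  have h_meas: "h \<in> borel_measurable (lebesgue_on (E 1))"
    using h_cont by (intro continuous_imp_measurable_on_sets_lebesgue) auto
  have "finite_measure (lebesgue_on (E 1))" using lmeasurable_E by (rule finite_measure_lebesgue_on)
  \<comment> \<open>Pairing with the constant 1 shows that \<open>h\<close> is integrable, since
    \<open>E 1\<close> has finite measure. Its modulus, times a bound for the polynomial factors, is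
    the dominating function.\<close>
  then have "integrable (lebesgue_on (E 1)) (\<lambda>z. h z * cnj 1)"
    using h_L2 h_meas by (intro integrable_mult_cnj) (auto intro: finite_measure.integrable_const)
  then have "integrable (lebesgue_on (E 1)) (\<lambda>z. (BP + BQ) * cmod (h z))" by simp
  then have dom: "integrable lebesgue (\<lambda>z. indicator (E 1) z *\<^sub>R ((BP + BQ) * cmod (h z)))"
    by (subst (asm) integrable_restrict_space) auto
  have s_bound: "norm (s n z) \<le> indicator (E 1) z *\<^sub>R ((BP + BQ) * cmod (h z))" for n z
  proof (cases "z \<in> E (\<rho> n)")
    case True
    then have z: "z \<in> E 1" using E_mono by blast
    have "norm (c n) \<le> 1"
      using \<rho>[of n] unfolding c_def norm_of_real by (simp add: abs_le_iff power_le_one)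
    have "norm (P z + c n * Q z) \<le> norm (P z) + norm (c n * Q z)" by (rule norm_triangle_ineq)
    also have "\<dots> \<le> BP + 1 * BQ"
      unfolding norm_mult using BP BQ z \<open>norm (c n) \<le> 1\<close> by (intro add_mono mult_mono) auto
    finally show ?thesis using True z by (simp add: s_def norm_mult mult_right_mono)
  next
    case False
    have "0 \<le> indicator (E 1) z *\<^sub>R ((BP + BQ) * cmod (h z))"
    proof (cases "z \<in> E 1")
      case True
      then have "0 \<le> BP + BQ" using BP BQ by (meson add_nonneg_nonneg norm_ge_zero order_trans)
      then show ?thesis by simp
    qed simp
    then show ?thesis using False by (simp add: s_def)
  qed
  have f_meas: "f \<in> borel_measurable lebesgue"
    unfolding f_def
    by (subst borel_measurable_restrict_space_iff[symmetric])
      (auto intro!: continuous_imp_measurable_on_sets_lebesgue continuous_intros P_meas h_cont)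
  have s_meas: "s n \<in> borel_measurable lebesgue" for n
    using s_int[of n] by (simp add: has_bochner_integral_iff borel_measurable_integrable)
  have "integrable lebesgue f"
    by (rule integrable_dominated_convergence[where s = s, OF f_meas _ dom]) (use s_meas s_lim s_bound in auto)
  moreover have "(\<lambda>n. integral\<^sup>L lebesgue (s n)) \<longlonglongrightarrow> integral\<^sup>L lebesgue f"
    by (rule integral_dominated_convergence[OF f_meas _ dom]) (use s_meas s_lim s_bound in auto)
  ultimately have "has_bochner_integral lebesgue f 0"
    using s_int by (simp add: has_bochner_integral_iff LIMSEQ_const_iff)
  then show ?thesis
    unfolding f_def P_def by (subst has_bochner_integral_restrict_space) auto
qed

lemma fischer_orthogonal:
  assumes q: "bipoly k m q" and h: "holomorphic_on_vec h (E 1)"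
    and h_L2: "integrable (lebesgue_on (E 1)) (\<lambda>z. (cmod (h z))\<^sup>2)"
  shows "has_bochner_integral (lebesgue_on (E 1)) (\<lambda>z. fischer (r 1) q z * cnj (h z)) 0"
proof -
  have "has_bochner_integral (lebesgue_on (E 1))
     (\<lambda>z. \<Sum>j\<in>UNIV. dz j (\<lambda>w. r 1 w * dbar j q w) z * cnj (h z)) (\<Sum>j\<in>(UNIV::'n set). 0)"
    by (intro has_bochner_integral_sum dz_orthogonal[OF bipoly_wirtinger[OF q]] h h_L2)
  then show ?thesis by (simp add: fischer_def sum_distrib_right)
qed

end

section \<open>Spans of monomials and the two polynomial spaces\<close>

interpretation cfun: vector_space "\<lambda>(c::complex) (f::'a \<Rightarrow> complex) x. c * f x"
  by standard (auto simp: fun_eq_iff algebra_simps)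

text \<open>Coefficients are attached to indices rather than to the functions \<open>m i\<close>,
  matching the definitions of the polynomial spaces; thus the question whether different exponents
  give different monomials does not arise.\<close>

lemma cfun_span_imageD:
  assumes "f \<in> cfun.span (m ` I)" "finite I"
  shows "\<exists>d. f = (\<lambda>x. \<Sum>i\<in>I. d i * m i x)"
proof -
  have "cfun.subspace {f. \<exists>d. f = (\<lambda>x. \<Sum>i\<in>I. d i * m i x)}"
  proof (rule cfun.subspaceI)
    show "0 \<in> {f. \<exists>d. f = (\<lambda>x. \<Sum>i\<in>I. d i * m i x)}"
      by (auto simp: fun_eq_iff intro!: exI[of _ "\<lambda>_. 0"])
  next
    fix f g assume "f \<in> {f. \<exists>d. f = (\<lambda>x. \<Sum>i\<in>I. d i * m i x)}" "g \<in> {f. \<exists>d. f = (\<lambda>x. \<Sum>i\<in>I. d i * m i x)}"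
    then obtain d e where "f = (\<lambda>x. \<Sum>i\<in>I. d i * m i x)" "g = (\<lambda>x. \<Sum>i\<in>I. e i * m i x)" by blast
    then have "f + g = (\<lambda>x. \<Sum>i\<in>I. (d i + e i) * m i x)"
      by (simp add: fun_eq_iff sum.distrib distrib_right)
    then show "f + g \<in> {f. \<exists>d. f = (\<lambda>x. \<Sum>i\<in>I. d i * m i x)}"
      by (intro CollectI exI[of _ "\<lambda>i. d i + e i"])
  next
    fix c f assume "f \<in> {f. \<exists>d. f = (\<lambda>x. \<Sum>i\<in>I. d i * m i x)}"
    then obtain d where "f = (\<lambda>x. \<Sum>i\<in>I. d i * m i x)" by blast
    then have "(\<lambda>x. c * f x) = (\<lambda>x. \<Sum>i\<in>I. (c * d i) * m i x)"
      by (simp add: fun_eq_iff sum_distrib_left mult.assoc)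
    then show "(\<lambda>x. c * f x) \<in> {f. \<exists>d. f = (\<lambda>x. \<Sum>i\<in>I. d i * m i x)}"
      by (intro CollectI exI[of _ "\<lambda>i. c * d i"])
  qed
  moreover have "m ` I \<subseteq> {f. \<exists>d. f = (\<lambda>x. \<Sum>i\<in>I. d i * m i x)}"
  proof (intro image_subsetI CollectI exI ext)
    fix i x assume "i \<in> I"
    have "(\<Sum>l\<in>I. (if l = i then 1 else 0) * m l x) = (\<Sum>l\<in>I. if l = i then m l x else 0)"
      by (intro sum.cong) auto
    then show "m i x = (\<Sum>l\<in>I. (if l = i then 1 else 0) * m l x)"
      using assms(2) \<open>i \<in> I\<close> by simp
  qed
  ultimately show ?thesis using cfun.span_minimal assms(1) by blast
qed

text \<open>Multiplication by a fixed function is linear, so the functions that it sends into a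
  given span form a subspace, and generators suffice.\<close>

lemma cfun_span_mult:
  assumes "f \<in> cfun.span S" "\<And>s. s \<in> S \<Longrightarrow> (\<lambda>z. c z * s z) \<in> cfun.span T"
  shows "(\<lambda>z. c z * f z) \<in> cfun.span T"
proof -
  have "cfun.subspace {f. (\<lambda>z. c z * f z) \<in> cfun.span T}"
  proof (rule cfun.subspaceI)
    show "0 \<in> {f. (\<lambda>z. c z * f z) \<in> cfun.span T}"
      using cfun.span_zero[of T] by (simp add: zero_fun_def)
  next
    fix f g assume "f \<in> {f. (\<lambda>z. c z * f z) \<in> cfun.span T}" "g \<in> {f. (\<lambda>z. c z * f z) \<in> cfun.span T}"
    then have "(\<lambda>z. c z * f z) + (\<lambda>z. c z * g z) \<in> cfun.span T" by (intro cfun.span_add) auto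
    then show "f + g \<in> {f. (\<lambda>z. c z * f z) \<in> cfun.span T}" by (simp add: plus_fun_def distrib_left)
  next
    fix d f assume "f \<in> {f. (\<lambda>z. c z * f z) \<in> cfun.span T}"
    then have "(\<lambda>z. d * (c z * f z)) \<in> cfun.span T" by (intro cfun.span_scale) auto
    then show "(\<lambda>x. d * f x) \<in> {f. (\<lambda>z. c z * f z) \<in> cfun.span T}" by (simp add: mult.left_commute)
  qed
  then have "cfun.span S \<subseteq> {f. (\<lambda>z. c z * f z) \<in> cfun.span T}"
    using assms(2) by (intro cfun.span_minimal) auto
  with assms(1) show ?thesis by blast
qed

lemma prod_power_Suc:
  fixes x :: "'n::finite \<Rightarrow> complex"
  shows "x j * (\<Prod>i\<in>UNIV. x i ^ \<gamma> i) = (\<Prod>i\<in>UNIV. x i ^ (\<gamma>(j := Suc (\<gamma> j))) i)"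
proof -
  have "(\<Prod>i\<in>UNIV - {j}. x i ^ (\<gamma>(j := Suc (\<gamma> j))) i) = (\<Prod>i\<in>UNIV - {j}. x i ^ \<gamma> i)"
    by (intro prod.cong) auto
  then show ?thesis by (simp add: prod.remove[of UNIV j])
qed

lemma multi_degree_Suc: "multi_degree (\<gamma>(j := Suc (\<gamma> j))) = Suc (multi_degree \<gamma>)"
proof -
  have "(\<Sum>i\<in>UNIV - {j}. (\<gamma>(j := Suc (\<gamma> j))) i) = (\<Sum>i\<in>UNIV - {j}. \<gamma> i)"
    by (intro sum.cong) auto
  then show ?thesis by (simp add: multi_degree_def sum.remove[of UNIV j])
qed

definition z_monomials :: "nat \<Rightarrow> (complex ^ 'n \<Rightarrow> complex) set" where
  "z_monomials N = (\<lambda>\<gamma> z. \<Prod>j\<in>UNIV. z $ j ^ \<gamma> j) ` {\<gamma>. multi_degree \<gamma> \<le> N}"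

definition xy_monomials :: "nat \<Rightarrow> (complex ^ 'n \<Rightarrow> complex) set" where
  "xy_monomials N = (\<lambda>(\<alpha>, \<beta>) z. (\<Prod>j\<in>UNIV. complex_of_real (Re (z $ j)) ^ \<alpha> j)
       * (\<Prod>j\<in>UNIV. complex_of_real (Im (z $ j)) ^ \<beta> j)) `
     {(\<alpha>, \<beta>). multi_degree \<alpha> + multi_degree \<beta> \<le> N}"

lemma bipoly_span_z_monomials:
  fixes f :: "complex ^ 'n \<Rightarrow> complex"
  shows "bipoly k m f \<Longrightarrow> m = 0 \<Longrightarrow> f \<in> cfun.span (z_monomials k)"
proof (induction rule: bipoly.induct)
  case (const k m c)
  have "(\<lambda>z. 1) \<in> (z_monomials k :: (complex ^ 'n \<Rightarrow> complex) set)"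
    unfolding z_monomials_def by (rule image_eqI[of _ _ "\<lambda>_. 0"]) (auto simp: multi_degree_def)
  from cfun.span_scale[OF cfun.span_base[OF this], of c] show ?case by simp
next
  case (add k m f g)
  then have "f + g \<in> cfun.span (z_monomials k)" by (intro cfun.span_add) auto
  then show ?case by (simp add: plus_fun_def)
next
  case (coord k m f j)
  show ?case
  proof (rule cfun_span_mult[OF coord.IH[OF coord.prems]])
    fix s :: "complex ^ 'n \<Rightarrow> complex" assume "s \<in> z_monomials k"
    then obtain \<gamma> where \<gamma>: "multi_degree \<gamma> \<le> k" "s = (\<lambda>z. \<Prod>i\<in>UNIV. z $ i ^ \<gamma> i)"
      by (auto simp: z_monomials_def)
    then show "(\<lambda>z. z $ j * s z) \<in> cfun.span (z_monomials (Suc k))"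
      unfolding z_monomials_def
      by (intro cfun.span_base image_eqI[of _ _ "\<gamma>(j := Suc (\<gamma> j))"]) (auto simp: prod_power_Suc multi_degree_Suc simp del: fun_upd_apply)
  qed
qed simp

lemma span_xy_monomials_mult:
  fixes f :: "complex ^ 'n \<Rightarrow> complex"
  assumes "f \<in> cfun.span (xy_monomials k)"
  shows "(\<lambda>z. complex_of_real (Re (z $ j)) * f z) \<in> cfun.span (xy_monomials (Suc k))" (is ?Re)
    and "(\<lambda>z. complex_of_real (Im (z $ j)) * f z) \<in> cfun.span (xy_monomials (Suc k))" (is ?Im)
proof -
  have *: "(\<lambda>z. complex_of_real (Re (z $ j)) * s z) \<in> cfun.span (xy_monomials (Suc k))
    \<and> (\<lambda>z. complex_of_real (Im (z $ j)) * s z) \<in> cfun.span (xy_monomials (Suc k))"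
    if s: "s \<in> xy_monomials k" for s :: "complex ^ 'n \<Rightarrow> complex"
  proof -
    from s obtain \<alpha> \<beta> where deg: "multi_degree \<alpha> + multi_degree \<beta> \<le> k"
      and s_eq: "s = (\<lambda>z. (\<Prod>j\<in>UNIV. complex_of_real (Re (z $ j)) ^ \<alpha> j)
       * (\<Prod>j\<in>UNIV. complex_of_real (Im (z $ j)) ^ \<beta> j))" by (auto simp: xy_monomials_def)
    have eq_Re: "(\<Prod>i\<in>UNIV. complex_of_real (Re (z $ i)) ^ (\<alpha>(j := Suc (\<alpha> j))) i)
        = complex_of_real (Re (z $ j)) * (\<Prod>i\<in>UNIV. complex_of_real (Re (z $ i)) ^ \<alpha> i)" for z :: "complex ^ 'n"
      by (rule prod_power_Suc[symmetric])
    have eq_Im: "(\<Prod>i\<in>UNIV. complex_of_real (Im (z $ i)) ^ (\<beta>(j := Suc (\<beta> j))) i)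
        = complex_of_real (Im (z $ j)) * (\<Prod>i\<in>UNIV. complex_of_real (Im (z $ i)) ^ \<beta> i)" for z :: "complex ^ 'n"
      by (rule prod_power_Suc[symmetric])
    have "(\<lambda>z. complex_of_real (Re (z $ j)) * s z) \<in> xy_monomials (Suc k)"
      unfolding xy_monomials_def s_eq
    proof (rule image_eqI[of _ _ "(\<alpha>(j := Suc (\<alpha> j)), \<beta>)"])
      show "(\<alpha>(j := Suc (\<alpha> j)), \<beta>) \<in> {(\<alpha>, \<beta>). multi_degree \<alpha> + multi_degree \<beta> \<le> Suc k}"
        using deg by (simp add: multi_degree_Suc del: fun_upd_apply)
    qed (simp only: prod.case eq_Re mult.assoc)
    moreover have "(\<lambda>z. complex_of_real (Im (z $ j)) * s z) \<in> xy_monomials (Suc k)"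
      unfolding xy_monomials_def s_eq
    proof (rule image_eqI[of _ _ "(\<alpha>, \<beta>(j := Suc (\<beta> j)))"])
      show "(\<alpha>, \<beta>(j := Suc (\<beta> j))) \<in> {(\<alpha>, \<beta>). multi_degree \<alpha> + multi_degree \<beta> \<le> Suc k}"
        using deg by (simp add: multi_degree_Suc del: fun_upd_apply)
    qed (simp only: prod.case eq_Im mult.left_commute)
    ultimately show ?thesis by (blast intro: cfun.span_base)
  qed
  show ?Re ?Im using * by (auto intro: cfun_span_mult[OF assms])
qed

text \<open>Each coordinate or conjugated coordinate splits into real part plus or minus
  \<open>\<i>\<close> times imaginary part, and both pieces raise the degree by one.\<close>

lemma bipoly_span_xy_monomials:
  fixes f :: "complex ^ 'n \<Rightarrow> complex"
  shows "bipoly k m f \<Longrightarrow> f \<in> cfun.span (xy_monomials k)"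
proof (induction rule: bipoly.induct)
  case (const k m c)
  have "(\<lambda>z. 1) \<in> (xy_monomials k :: (complex ^ 'n \<Rightarrow> complex) set)"
    unfolding xy_monomials_def by (rule image_eqI[of _ _ "(\<lambda>_. 0, \<lambda>_. 0)"]) (auto simp: multi_degree_def)
  from cfun.span_scale[OF cfun.span_base[OF this], of c] show ?case by simp
next
  case (add k m f g)
  then have "f + g \<in> cfun.span (xy_monomials k)" by (intro cfun.span_add)
  then show ?case by (simp add: plus_fun_def)
next
  case (coord k m f j)
  have "(\<lambda>z. complex_of_real (Re (z $ j)) * f z) + (\<lambda>z. \<i> * (complex_of_real (Im (z $ j)) * f z))
      \<in> cfun.span (xy_monomials (Suc k))"
    by (intro cfun.span_add cfun.span_scale span_xy_monomials_mult coord.IH)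
  also have "(\<lambda>z. complex_of_real (Re (z $ j)) * f z) + (\<lambda>z. \<i> * (complex_of_real (Im (z $ j)) * f z))
      = (\<lambda>z. z $ j * f z)"
    by (auto simp: fun_eq_iff complex_eq_iff)
  finally show ?case .
next
  case (coord_cnj k m f j)
  have "(\<lambda>z. complex_of_real (Re (z $ j)) * f z) + (\<lambda>z. - \<i> * (complex_of_real (Im (z $ j)) * f z))
      \<in> cfun.span (xy_monomials (Suc k))"
    by (intro cfun.span_add cfun.span_scale span_xy_monomials_mult coord_cnj.IH)
  also have "(\<lambda>z. complex_of_real (Re (z $ j)) * f z) + (\<lambda>z. - \<i> * (complex_of_real (Im (z $ j)) * f z))
      = (\<lambda>z. cnj (z $ j) * f z)"
    by (auto simp: fun_eq_iff complex_eq_iff)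
  finally show ?case .
qed

lemma hol_poly_space_eq: "hol_poly_space \<Omega> N = (\<lambda>f. restrict f \<Omega>) ` {f. bipoly N 0 f}"
proof (intro set_eqI iffI)
  fix f assume "f \<in> hol_poly_space \<Omega> N"
  then obtain d where f: "f = (\<lambda>z\<in>\<Omega>. \<Sum>\<gamma> | multi_degree \<gamma> \<le> N. d \<gamma> * (\<Prod>j\<in>UNIV. z $ j ^ \<gamma> j))"
    by (auto simp: hol_poly_space_def)
  have "bipoly N 0 (\<lambda>z. \<Prod>j\<in>UNIV. z $ j ^ \<gamma> j)" if "multi_degree \<gamma> \<le> N" for \<gamma> :: "'a \<Rightarrow> nat"
    by (rule bipoly_mono[OF bipoly_prod_power[OF bipoly_coord]]) (use that in \<open>auto simp: multi_degree_def\<close>)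
  then show "f \<in> (\<lambda>f. restrict f \<Omega>) ` {f. bipoly N 0 f}"
    unfolding f by (intro imageI CollectI bipoly_sum bipoly_cmult) auto
next
  fix f assume "f \<in> (\<lambda>f. restrict f \<Omega>) ` {f. bipoly N 0 f}"
  then obtain g where g: "bipoly N 0 g" "f = restrict g \<Omega>" by blast
  obtain d where "g = (\<lambda>z. \<Sum>\<gamma> | multi_degree \<gamma> \<le> N. d \<gamma> * (\<Prod>j\<in>UNIV. z $ j ^ \<gamma> j))"
    using cfun_span_imageD[OF bipoly_span_z_monomials[OF g(1) refl, unfolded z_monomials_def] finite_multi_degree_le]
    by blast
  with g(2) show "f \<in> hol_poly_space \<Omega> N" by (auto simp: hol_poly_space_def)
qed

lemma poly_space_eq: "poly_space \<Omega> N = (\<lambda>f. restrict f \<Omega>) ` {f. bipoly N N f}"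
proof (intro set_eqI iffI)
  fix f assume "f \<in> poly_space \<Omega> N"
  then obtain c where f: "f = (\<lambda>z\<in>\<Omega>. \<Sum>(\<alpha>, \<beta>) | multi_degree \<alpha> + multi_degree \<beta> \<le> N.
         c \<alpha> \<beta> * (\<Prod>j\<in>UNIV. complex_of_real (Re (z $ j)) ^ \<alpha> j)
               * (\<Prod>j\<in>UNIV. complex_of_real (Im (z $ j)) ^ \<beta> j))"
    by (auto simp: poly_space_def)
  have "bipoly N N (\<lambda>z. c \<alpha> \<beta> * (\<Prod>j\<in>UNIV. complex_of_real (Re (z $ j)) ^ \<alpha> j)
               * (\<Prod>j\<in>UNIV. complex_of_real (Im (z $ j)) ^ \<beta> j))"
    if "multi_degree \<alpha> + multi_degree \<beta> \<le> N" for \<alpha> \<beta> :: "'a \<Rightarrow> nat"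
    by (rule bipoly_mono[OF bipoly_mult[OF bipoly_cmult[OF bipoly_prod_power[OF bipoly_Re]]
        bipoly_prod_power[OF bipoly_Im]]]) (use that in \<open>auto simp: multi_degree_def\<close>)
  then show "f \<in> (\<lambda>f. restrict f \<Omega>) ` {f. bipoly N N f}"
    unfolding f case_prod_beta by (intro imageI CollectI bipoly_sum) auto
next
  fix f assume "f \<in> (\<lambda>f. restrict f \<Omega>) ` {f. bipoly N N f}"
  then obtain g where g: "bipoly N N g" "f = restrict g \<Omega>" by blast
  obtain d where "g = (\<lambda>z. \<Sum>p | case p of (\<alpha>, \<beta>) \<Rightarrow> multi_degree \<alpha> + multi_degree \<beta> \<le> N.
      d p * (case p of (\<alpha>, \<beta>) \<Rightarrow> \<lambda>z. (\<Prod>j\<in>UNIV. complex_of_real (Re (z $ j)) ^ \<alpha> j)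
       * (\<Prod>j\<in>UNIV. complex_of_real (Im (z $ j)) ^ \<beta> j)) z)"
    using cfun_span_imageD[OF bipoly_span_xy_monomials[OF g(1), unfolded xy_monomials_def] finite_multi_degree_pair_le]
    by blast
  then have "g = (\<lambda>z. \<Sum>(\<alpha>, \<beta>) | multi_degree \<alpha> + multi_degree \<beta> \<le> N.
         d (\<alpha>, \<beta>) * (\<Prod>j\<in>UNIV. complex_of_real (Re (z $ j)) ^ \<alpha> j)
               * (\<Prod>j\<in>UNIV. complex_of_real (Im (z $ j)) ^ \<beta> j))"
    by (simp add: case_prod_unfold mult.assoc)
  with g(2) show "f \<in> poly_space \<Omega> N"
    unfolding poly_space_def by (intro CollectI exI[of _ "\<lambda>\<alpha> \<beta>. d (\<alpha>, \<beta>)"]) simp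
qed

section \<open>Computing the Bergman projection\<close>

text \<open>Two candidates \<open>h\<close> and \<open>h'\<close> are both tested against their own
  difference. Subtracting the two relations shows that \<open>h - h'\<close> has norm 0; by
  continuity it vanishes on \<open>\<Omega>\<close>, and extensionality makes the candidates equal
  as functions, as the definite description requires.\<close>

lemma bergman_projection_eqI:
  assumes \<Omega>: "open \<Omega>" and f: "f \<in> L2_space \<Omega>" and h: "h \<in> bergman_space \<Omega>"
    and orth: "\<And>g. g \<in> bergman_space \<Omega> \<Longrightarrow> L2_inner \<Omega> (\<lambda>z. f z - h z) g = 0"
  shows "bergman_projection \<Omega> f = h"
proof -
  have "h' = h" if h': "h' \<in> bergman_space \<Omega>"
    and orth': "\<forall>g\<in>bergman_space \<Omega>. L2_inner \<Omega> (\<lambda>z. f z - h' z) g = 0" for h'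
  proof -
    have [measurable]: "f \<in> borel_measurable (lebesgue_on \<Omega>)" "h \<in> borel_measurable (lebesgue_on \<Omega>)"
        "h' \<in> borel_measurable (lebesgue_on \<Omega>)"
      and int: "integrable (lebesgue_on \<Omega>) (\<lambda>z. (cmod (f z))\<^sup>2)"
        "integrable (lebesgue_on \<Omega>) (\<lambda>z. (cmod (h z))\<^sup>2)" "integrable (lebesgue_on \<Omega>) (\<lambda>z. (cmod (h' z))\<^sup>2)"
      using f h h' by (auto simp: L2_space_def bergman_space_def)
    have hol: "holomorphic_on_vec h \<Omega>" "holomorphic_on_vec h' \<Omega>"
      using h h' by (auto simp: bergman_space_def)
    \<comment> \<open>The restriction makes the difference extensional and hence a legitimate
      element of \<open>L2_space \<Omega>\<close>.\<close>
    define g where "g = restrict (\<lambda>z. h z - h' z) \<Omega>"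
    have g_hol: "holomorphic_on_vec g \<Omega>"
      unfolding g_def by (rule holomorphic_on_vec_cong[OF \<Omega> _ holomorphic_on_vec_diff[OF hol]]) simp
    have "(\<lambda>z. h z - h' z) \<in> borel_measurable (lebesgue_on \<Omega>)" by measurable
    then have g_meas [measurable]: "g \<in> borel_measurable (lebesgue_on \<Omega>)"
      by (rule measurable_cong[THEN iffD1, rotated]) (simp add: g_def)
    have sq_diff: "integrable (lebesgue_on \<Omega>) (\<lambda>z. (cmod (u z - v z))\<^sup>2)"
      if [measurable]: "u \<in> borel_measurable (lebesgue_on \<Omega>)" "v \<in> borel_measurable (lebesgue_on \<Omega>)"
        and "integrable (lebesgue_on \<Omega>) (\<lambda>z. (cmod (u z))\<^sup>2)" "integrable (lebesgue_on \<Omega>) (\<lambda>z. (cmod (v z))\<^sup>2)"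
      for u v :: "complex ^ 'a \<Rightarrow> complex"
    proof (rule Bochner_Integration.integrable_bound)
      show "integrable (lebesgue_on \<Omega>) (\<lambda>z. 2 * (cmod (u z))\<^sup>2 + 2 * (cmod (v z))\<^sup>2)" using that by simp
      have "(cmod (u z - v z))\<^sup>2 \<le> 2 * (cmod (u z))\<^sup>2 + 2 * (cmod (v z))\<^sup>2" for z
      proof -
        have "(cmod (u z - v z))\<^sup>2 \<le> (cmod (u z) + cmod (v z))\<^sup>2"
          by (intro power_mono norm_triangle_ineq4) simp
        also have "\<dots> \<le> 2 * (cmod (u z))\<^sup>2 + 2 * (cmod (v z))\<^sup>2"
          using sum_squares_bound[of "cmod (u z)" "cmod (v z)"] by (simp add: power2_sum)
        finally show ?thesis .
      qed
      then show "AE z in lebesgue_on \<Omega>. norm ((cmod (u z - v z))\<^sup>2)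
          \<le> norm (2 * (cmod (u z))\<^sup>2 + 2 * (cmod (v z))\<^sup>2)" by simp
    qed measurable
    have g_int: "integrable (lebesgue_on \<Omega>) (\<lambda>z. (cmod (g z))\<^sup>2)"
    proof -
      have "integrable (lebesgue_on \<Omega>) (\<lambda>z. (cmod (h z - h' z))\<^sup>2)" by (intro sq_diff int) measurable
      also have "?this \<longleftrightarrow> ?thesis" by (rule Bochner_Integration.integrable_cong) (auto simp: g_def)
      finally show ?thesis .
    qed
    have g: "g \<in> bergman_space \<Omega>"
      using g_hol g_meas g_int by (simp add: bergman_space_def L2_space_def g_def)
    have i: "integrable (lebesgue_on \<Omega>) (\<lambda>z. (f z - h' z) * cnj (g z))"
        "integrable (lebesgue_on \<Omega>) (\<lambda>z. (f z - h z) * cnj (g z))"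
      by (intro integrable_mult_cnj sq_diff int g_int; measurable)+
    then have "has_bochner_integral (lebesgue_on \<Omega>)
        (\<lambda>z. (f z - h' z) * cnj (g z) - (f z - h z) * cnj (g z)) (0 - 0)"
      using orth[OF g] orth' g
      by (intro has_bochner_integral_diff) (auto simp: has_bochner_integral_iff L2_inner_def)
    also have "?this \<longleftrightarrow> has_bochner_integral (lebesgue_on \<Omega>) (\<lambda>z. complex_of_real ((cmod (h z - h' z))\<^sup>2)) 0"
    proof (rule has_bochner_integral_cong)
      fix z assume "z \<in> space (lebesgue_on \<Omega>)"
      then show "(f z - h' z) * cnj (g z) - (f z - h z) * cnj (g z) = complex_of_real ((cmod (h z - h' z))\<^sup>2)"
        unfolding complex_norm_square by (simp add: g_def algebra_simps)
    qed auto
    finally have "has_bochner_integral (lebesgue_on \<Omega>) (\<lambda>z. Re (complex_of_real ((cmod (h z - h' z))\<^sup>2))) (Re 0)"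
      by (rule has_bochner_integral_Re)
    then have "has_bochner_integral (lebesgue_on \<Omega>) (\<lambda>z. (cmod (h z - h' z))\<^sup>2) 0"
      by (simp only: Re_complex_of_real complex.sel zero_complex.sel)
    then have "(cmod (h z - h' z))\<^sup>2 = 0" if "z \<in> \<Omega>" for z
      using that hol by (intro nonneg_integral_0_imp_0[OF \<Omega>] continuous_intros
          holomorphic_on_vec_continuous_on) auto
    moreover have "h \<in> extensional \<Omega>" "h' \<in> extensional \<Omega>"
      using h h' by (auto simp: bergman_space_def L2_space_def)
    ultimately show ?thesis by (intro extensionalityI[of h' \<Omega> h]) auto
  qed
  then show ?thesis
    unfolding bergman_projection_def restrict_apply'[OF f] using h orth
    by (intro the_equality) blast+
qed

context affine_ball
begin

lemma bipoly_L2: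
  assumes "bipoly k m f"
  shows "integrable (lebesgue_on (E 1)) (\<lambda>z. (cmod (f z))\<^sup>2)"
proof -
  obtain B where B: "\<forall>z\<in>E 1. cmod (f z) \<le> B" using bipoly_bounded[OF bounded_E assms] by blast
  have "finite_measure (lebesgue_on (E 1))" using lmeasurable_E by (rule finite_measure_lebesgue_on)
  moreover have "AE z in lebesgue_on (E 1). norm ((cmod (f z))\<^sup>2) \<le> B\<^sup>2"
    using B by (intro AE_I2) (auto intro!: power_mono)
  moreover have "(\<lambda>z. (cmod (f z))\<^sup>2) \<in> borel_measurable (lebesgue_on (E 1))"
    by (intro continuous_imp_measurable_on_sets_lebesgue continuous_intros bipoly_continuous_on[OF assms] E_sets)
  ultimately show ?thesis by (rule finite_measure.integrable_const_bound)
qed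

lemma restrict_bipoly_L2_space: "bipoly k m f \<Longrightarrow> restrict f (E 1) \<in> L2_space (E 1)"
proof -
  assume f: "bipoly k m f"
  have "f \<in> borel_measurable (lebesgue_on (E 1))"
    by (intro continuous_imp_measurable_on_sets_lebesgue bipoly_continuous_on[OF f] E_sets)
  then have "restrict f (E 1) \<in> borel_measurable (lebesgue_on (E 1))"
    by (rule measurable_cong[THEN iffD1, rotated]) simp
  moreover have "integrable (lebesgue_on (E 1)) (\<lambda>z. (cmod (restrict f (E 1) z))\<^sup>2)"
    using bipoly_L2[OF f] by (rule Bochner_Integration.integrable_cong[THEN iffD1, rotated 2]) auto
  ultimately show ?thesis by (simp add: L2_space_def)
qed

text \<open>Kernel plus range, with \<open>K\<close> given by vanishing of
  \<open>fischer (r 1)\<close> on \<open>E 1\<close> only. The component in \<open>K\<close> is then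
  exchanged for a holomorphic polynomial with the same values on \<open>E 1\<close>.\<close>

lemma fischer_decomposition:
  assumes p: "bipoly N N p"
  shows "\<exists>h q. bipoly N 0 h \<and> bipoly N N q \<and> (\<forall>z\<in>E 1. p z = h z + fischer (r 1) q z)"
proof -
  let ?V = "{f. bipoly N N f} :: (complex ^ 'n \<Rightarrow> complex) set" and ?F = "fischer (r 1)"
  let ?K = "{f \<in> ?V. \<forall>z\<in>E 1. ?F f z = 0}"
  have "\<exists>h\<in>?K. \<exists>q\<in>?V. p = h + ?F q"
  proof (rule cfun.kernel_plus_range)
    show "finite (xy_monomials N :: (complex ^ 'n \<Rightarrow> complex) set)"
      unfolding xy_monomials_def by (intro finite_imageI finite_multi_degree_pair_le)
    show "?V \<subseteq> cfun.span (xy_monomials N)" using bipoly_span_xy_monomials by blast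
    show "cfun.subspace ?V"
      by (rule cfun.subspaceI) (auto simp: zero_fun_def plus_fun_def intro: bipoly.intros bipoly_cmult)
    show "?F f \<in> ?V" if "f \<in> ?V" for f using that bipoly_fischer[OF bipoly_r] by blast
    show "?F (f + g) = ?F f + ?F g" if "f \<in> ?V" "g \<in> ?V" for f g
      using that fischer_add[OF bipoly_r] by (simp add: plus_fun_def)
    show "?F (\<lambda>x. c * f x) = (\<lambda>x. c * ?F f x)" if "f \<in> ?V" for c f
      using that fischer_cmult[OF bipoly_r] by simp
    have "?F (\<lambda>z. 0) = (\<lambda>z. 0)" by (rule ext) (simp add: fischer_def)
    then show "0 \<in> ?K" by (simp add: zero_fun_def bipoly.const)
    show "?K \<subseteq> ?V" by blast
    show "(\<lambda>x. c * f x) \<in> ?K" if "f \<in> ?K" for c f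
      using that fischer_cmult[OF bipoly_r, where N = N and p = f and c = c] by (simp add: bipoly_cmult)
    show "p \<in> ?V" using p by blast
    \<comment> \<open>Kernel and range meet trivially on \<open>E 1\<close>: if \<open>?F f\<close>
      is in the kernel, it is holomorphic on \<open>E 1\<close>, while as a value of
      \<open>?F\<close> it is orthogonal to all Bergman functions, in particular to itself.\<close>
    show "f \<in> ?K" if f: "f \<in> ?V" "?F f \<in> ?K" for f
    proof -
      let ?q = "?F f"
      have q: "bipoly N N ?q" and q0: "\<And>z. z \<in> E 1 \<Longrightarrow> ?F ?q z = 0" using f by auto
      have dbar: "dbar j ?q z = 0" if "z \<in> E 1" for j z
        using fischer_zero_imp_dbar_zero[OF q q0 that] .
      have "holomorphic_on_vec ?q (E 1)"
        unfolding holomorphic_on_vec_def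
      proof
        fix z assume z: "z \<in> E 1"
        obtain D where D: "(?q has_derivative D) (at z)"
          using bipoly_differentiable[OF q, of z] by (auto simp: differentiable_def)
        with dbar_zero_complex_linear[OF D dbar[OF z]]
        show "\<exists>D. (?q has_derivative D) (at z) \<and> (\<forall>c v. D (c *s v) = c * D v)" by blast
      qed
      \<comment> \<open>The squared modulus is read as \<open>?q z * cnj (?q z)\<close>, so that
        \<open>?q\<close> serves as the test function in \<open>fischer_orthogonal\<close> for
        \<open>f\<close>.\<close>
      then have "has_bochner_integral (lebesgue_on (E 1)) (\<lambda>z. complex_of_real ((cmod (?q z))\<^sup>2)) 0"
        unfolding complex_norm_square using f(1) by (intro fischer_orthogonal bipoly_L2[OF q]) auto
      then have "has_bochner_integral (lebesgue_on (E 1)) (\<lambda>z. Re (complex_of_real ((cmod (?q z))\<^sup>2))) (Re 0)"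
        by (rule has_bochner_integral_Re)
      then have "has_bochner_integral (lebesgue_on (E 1)) (\<lambda>z. (cmod (?q z))\<^sup>2) 0"
        by (simp only: Re_complex_of_real complex.sel zero_complex.sel)
      then have "(cmod (?q z))\<^sup>2 = 0" if "z \<in> E 1" for z
        using that by (intro nonneg_integral_0_imp_0[OF open_E] continuous_intros bipoly_continuous_on[OF q]) auto
      then show ?thesis using f(1) by simp
    qed
  qed
  then obtain h q where h: "bipoly N N h" "\<And>z. z \<in> E 1 \<Longrightarrow> ?F h z = 0" and q: "bipoly N N q" and eq: "p = h + ?F q"
    by blast
  obtain h' where "bipoly N 0 h'" "\<forall>z\<in>E 1. h z = h' z"
    using dbar_zero_imp_holomorphic_bipoly[OF open_E h(1) fischer_zero_imp_dbar_zero[OF h]] by blast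
  with q eq show ?thesis by (intro exI[of _ h'] exI[of _ q]) simp
qed

text \<open>\<open>h\<close> is itself in the Bergman space, and on \<open>E 1\<close> the
  difference \<open>p - h\<close> is a value of \<open>fischer (r 1)\<close>, hence orthogonal to
  that space.\<close>

lemma bergman_projection_bipoly:
  assumes h: "bipoly N 0 h" and q: "bipoly N N q" and p: "bipoly N N p"
    and eq: "\<And>z. z \<in> E 1 \<Longrightarrow> p z = h z + fischer (r 1) q z"
  shows "bergman_projection (E 1) (restrict p (E 1)) = restrict h (E 1)"
proof (rule bergman_projection_eqI[OF open_E])
  show "restrict p (E 1) \<in> L2_space (E 1)" using p by (rule restrict_bipoly_L2_space)
  have "holomorphic_on_vec (restrict h (E 1)) (E 1)"
    by (rule holomorphic_on_vec_cong[OF open_E _ bipoly_holomorphic[OF h]]) simp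
  then show "restrict h (E 1) \<in> bergman_space (E 1)"
    using restrict_bipoly_L2_space[OF h] by (simp add: bergman_space_def)
next
  fix g assume g: "g \<in> bergman_space (E 1)"
  have "L2_inner (E 1) (\<lambda>z. restrict p (E 1) z - restrict h (E 1) z) g
      = (LINT z|lebesgue_on (E 1). fischer (r 1) q z * cnj (g z))"
    unfolding L2_inner_def by (intro Bochner_Integration.integral_cong) (auto simp: eq)
  also have "\<dots> = 0"
    using g by (intro has_bochner_integral_integral_eq fischer_orthogonal[OF q])
      (auto simp: bergman_space_def L2_space_def)
  finally show "L2_inner (E 1) (\<lambda>z. restrict p (E 1) z - restrict h (E 1) z) g = 0" .
qed

end

theorem theorem3p1:
  fixes \<Omega> :: "(complex ^ 'n) set" and N :: nat
  assumes "ellipsoid \<Omega>"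
  shows "bergman_projection \<Omega> ` poly_space \<Omega> N = hol_poly_space \<Omega> N"
proof -
  obtain A :: "complex ^ 'n \<Rightarrow> complex ^ 'n" and a where A: "linear A" "bij A" "\<Omega> = (\<lambda>v. a + A v) ` ball 0 1"
    using assms by (auto simp: ellipsoid_def)
  interpret affine_ball A a using A(1,2) by (rule affine_ball.intro)
  have \<Omega>: "\<Omega> = E 1" using A(3) by (simp add: E_eq_image)
  show ?thesis
  proof (intro set_eqI iffI)
    fix f assume "f \<in> bergman_projection \<Omega> ` poly_space \<Omega> N"
    then obtain p where p: "bipoly N N p" "f = bergman_projection \<Omega> (restrict p \<Omega>)"
      by (auto simp: poly_space_eq)
    obtain h q where "bipoly N 0 h" "bipoly N N q" "\<forall>z\<in>E 1. p z = h z + fischer (r 1) q z"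
      using fischer_decomposition[OF p(1)] by blast
    then show "f \<in> hol_poly_space \<Omega> N"
      using bergman_projection_bipoly[of N h q p] p by (auto simp: \<Omega> hol_poly_space_eq)
  next
    fix f assume "f \<in> hol_poly_space \<Omega> N"
    then obtain h where h: "bipoly N 0 h" "f = restrict h \<Omega>" by (auto simp: hol_poly_space_eq)
    have h': "bipoly N N h" using h(1) by (rule bipoly_mono) auto
    \<comment> \<open>A holomorphic polynomial is its own projection: its decomposition has
      \<open>q = 0\<close>, for which the Fischer term vanishes.\<close>
    have "bergman_projection \<Omega> (restrict h \<Omega>) = f"
      using bergman_projection_bipoly[OF h(1) bipoly.const[of _ _ 0] h'] h(2)
      by (simp add: \<Omega> fischer_def)
    then show "f \<in> bergman_projection \<Omega> ` poly_space \<Omega> N"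
      using h' by (auto simp: poly_space_eq intro: image_eqI)
  qed
qed

end
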